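(* Assume $|U|\ge 2$ and suppose that $g_U(x)\sim Gx^{\beta}$ as $x\to\infty$ (i.e. $g_U(x)/(Gx^\beta)\to 1$) with $\beta,G\in(0,\infty)$. Let $M_c=M_c(r)$ be the critical time scale of the external model, i.e. the unique solution $M$ of $M\nu(M)=1$. Then $$M_c = F_c\, r^{\,1\wedge \beta(|U|-1)}\,[1+o(1)],\qquad r\to\infty,$$ where $a\wedge b=\min\{a,b\}$ and $$F_c=\begin{cases}\dfrac{\gamma_U^{\beta(|U|-1)}}{|U|\,G^{-(|U|-1)}}, & \beta\in\left(0,\frac{1}{|U|-1}\right),\\[2mm] \dfrac{\gamma_U}{|U|\,G^{-(|U|-1)}+(c-\rho_U)}, & \beta=\frac{1}{|U|-1},\\[2mm] \dfrac{\gamma_U}{c-\rho_U}, & \beta\in\left(\frac{1}{|U|-1},\infty\right).\end{cases}$$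
   Context: Network: $U,V$ are disjoint finite nonempty sets; the interference graph is the complete bipartite graph on $N=U\cup V$, in which two nodes are neighbors iff one lies in $U$ and the other in $V$. Each node $i$ has a state $X_i(t)\in\{0,1\}$ at time $t\ge 0$ ($0$ = inactive, $1$ = active). Each node $i$ carries a deactivation Poisson clock of rate $1$ and an activation Poisson clock with rate $r_i(t)$ at time $t$; clocks are independent. An active node becomes inactive when its deactivation clock ticks; an inactive node becomes active when its activation clock ticks at a time $t$, provided no neighbor is active at time $t^-$. $u$ is the configuration with all nodes of $U$ active and all nodes of $V$ inactive; $v$ is the configuration with all nodes of $U$ inactive and all nodes of $V$ active. $\mathbb{E}_u$ denotes expectation when starting from $u$, and $\tau_v=\min\{t\ge 0: X(t)=v\}$ is the transition time. Parameters: $c,\rho_U,\rho_V,\gamma_U,\gamma_V$ are constants with $c>\rho_U>0$, $c>\rho_V>0$, $\gamma_U\ge\gamma_V>0$; $r>0$ is a parameter tending to infinity. $\mathcal{G}$ is the class of continuous non-decreasing functions $g:\mathbb{R}\to\mathbb{R}_{\ge0}$ with $g(x)=0$ for $x\le 0$ and $\lim_{x\to\infty}g(x)=\infty$. Standing assumption: $g_U,g_V\in\mathcal{G}$ and $\lim_{x\to\infty}g_V(x)/g_U(x)=\infty$. External model: the activation rates are deterministic: $r_i(t)=r_U(t)=g_U(\gamma_U r-(c-\rho_U)t)$ for $i\in U$ and $r_i(t)=r_V(t)=g_V(\gamma_V r+\rho_V t)$ for $i\in V$, $t\ge 0$. For $s\ge 0$, $\nu(s)=1/\mathbb{E}_u[\tau_v](s)$,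 where $\mathbb{E}_u[\tau_v](s)$ is the mean transition time from $u$ to $v$ in the time-homogeneous model in which the activation rates are frozen at time $s$, i.e. constantly equal to $r_U(s)$ for nodes in $U$ and $r_V(s)$ for nodes in $V$. *)

theory Defs
  imports "HOL-Probability.Probability" "HOL-Library.Landau_Symbols"
begin

definition class_G :: "(real \<Rightarrow> real) set" where
  "class_G = {g. continuous_on UNIV g \<and> mono g \<and> (\<forall>x. 0 \<le> g x) \<and> (\<forall>x\<le>0. g x = 0) \<and>
                 filterlim g at_top at_top}"

definition neighbors :: "'a set \<Rightarrow> 'a set \<Rightarrow> 'a \<Rightarrow> 'a \<Rightarrow> bool" where
  "neighbors U V i j \<longleftrightarrow> (i \<in> U \<and> j \<in> V) \<or> (i \<in> V \<and> j \<in> U)"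

datatype 'a clock = Deactivation 'a | Activation 'a

definition clocks :: "'a set \<Rightarrow> 'a clock set" where
  "clocks N = Deactivation ` N \<union> Activation ` N"

fun clock_rate :: "('a \<Rightarrow> real) \<Rightarrow> 'a clock \<Rightarrow> real" where
  "clock_rate a (Deactivation i) = 1"
| "clock_rate a (Activation i) = a i"

text \<open>
  Independent Poisson clocks of constant rates: a sample point assigns to clock \<open>k\<close> a sequence of
  independent exponential(1) variables, and the gaps between consecutive ticks of a clock
  of rate \<open>l > 0\<close> are these variables divided by \<open>l\<close>. A clock of rate \<open>0\<close> never ticks.
\<close>

definition clock_space :: "'a set \<Rightarrow> ('a clock \<times> nat \<Rightarrow> real) measure" where
  "clock_space N = PiM (clocks N \<times> UNIV) (\<lambda>_. density lborel (exponential_density 1))"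

definition clock_ticks :: "('a \<Rightarrow> real) \<Rightarrow> ('a clock \<times> nat \<Rightarrow> real) \<Rightarrow> 'a clock \<Rightarrow> real set" where
  "clock_ticks a \<omega> k =
     (if clock_rate a k = 0 then {} else {(\<Sum>m\<le>n. \<omega> (k, m) / clock_rate a k) | n. True})"

definition all_ticks ::
    "'a set \<Rightarrow> ('a \<Rightarrow> real) \<Rightarrow> ('a clock \<times> nat \<Rightarrow> real) \<Rightarrow> real set" where
  "all_ticks N a \<omega> = (\<Union>k\<in>clocks N. clock_ticks a \<omega> k)"

text \<open>
  A configuration is represented by its set of active nodes, so that the configurations
  \<open>u\<close> and \<open>v\<close> are \<open>U\<close> and \<open>V\<close>.  In \<open>update\<close>, the argument \<open>x\<close> is the configuration just before
  time \<open>t\<close> and the result is the configuration at time \<open>t\<close>.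
\<close>

definition update ::
    "'a set \<Rightarrow> 'a set \<Rightarrow> ('a \<Rightarrow> real) \<Rightarrow> ('a clock \<times> nat \<Rightarrow> real) \<Rightarrow> real \<Rightarrow> 'a set \<Rightarrow> 'a set" where
  "update U V a \<omega> t x =
     {i \<in> U \<union> V. if i \<in> x then t \<notin> clock_ticks a \<omega> (Deactivation i)
                 else t \<in> clock_ticks a \<omega> (Activation i) \<and> (\<forall>j. neighbors U V i j \<longrightarrow> j \<notin> x)}"

text \<open>
  The configuration at time \<open>t\<close> arises from the initial one by processing the ticks in
  \<open>(0, t]\<close> in increasing order; almost surely there are finitely many of them for every \<open>t\<close>.
\<close>

definition process ::
    "'a set \<Rightarrow> 'a set \<Rightarrow> ('a \<Rightarrow> real) \<Rightarrow> 'a set \<Rightarrow> ('a clock \<times> nat \<Rightarrow> real) \<Rightarrow> real \<Rightarrow> 'a set" where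
  "process U V a x0 \<omega> t =
     fold (update U V a \<omega>) (sorted_list_of_set (all_ticks (U \<union> V) a \<omega> \<inter> {0<..t})) x0"

text \<open>The infimum over the empty set is \<open>\<infinity>\<close>; almost surely paths are right-continuous, so that
  the infimum is a minimum whenever it is finite.\<close>

definition hitting_time ::
    "'a set \<Rightarrow> 'a set \<Rightarrow> ('a \<Rightarrow> real) \<Rightarrow> 'a set \<Rightarrow> 'a set \<Rightarrow> ('a clock \<times> nat \<Rightarrow> real) \<Rightarrow> ennreal" where
  "hitting_time U V a x0 y \<omega> = (INF t\<in>{t. 0 \<le> t \<and> process U V a x0 \<omega> t = y}. ennreal t)"

definition mean_transition_time :: "'a set \<Rightarrow> 'a set \<Rightarrow> ('a \<Rightarrow> real) \<Rightarrow> ennreal" where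
  "mean_transition_time U V a = (\<integral>\<^sup>+\<omega>. hitting_time U V a U V \<omega> \<partial>clock_space (U \<union> V))"

text \<open>
  \<open>rU\<close> and \<open>rV\<close> are the time-dependent activation rates, frozen at time \<open>s\<close>.  The division is
  in the extended reals, so that \<open>nu = 0\<close> when the mean transition time is infinite.
\<close>

definition nu :: "'a set \<Rightarrow> 'a set \<Rightarrow> (real \<Rightarrow> real) \<Rightarrow> (real \<Rightarrow> real) \<Rightarrow> real \<Rightarrow> real" where
  "nu U V rU rV s =
     enn2real (1 / mean_transition_time U V (\<lambda>i. if i \<in> U then rU s else rV s))"

definition is_critical_time ::
    "'a set \<Rightarrow> 'a set \<Rightarrow> (real \<Rightarrow> real) \<Rightarrow> (real \<Rightarrow> real) \<Rightarrow> real \<Rightarrow> bool" where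
  "is_critical_time U V rU rV M \<longleftrightarrow> 0 \<le> M \<and> M * nu U V rU rV M = 1"

definition critical_time :: "'a set \<Rightarrow> 'a set \<Rightarrow> (real \<Rightarrow> real) \<Rightarrow> (real \<Rightarrow> real) \<Rightarrow> real" where
  "critical_time U V rU rV = (THE M. is_critical_time U V rU rV M)"

definition external_rate_U ::
    "(real \<Rightarrow> real) \<Rightarrow> real \<Rightarrow> real \<Rightarrow> real \<Rightarrow> real \<Rightarrow> real \<Rightarrow> real" where
  "external_rate_U gU \<gamma>U c \<rho>U r t = gU (\<gamma>U * r - (c - \<rho>U) * t)"

definition external_rate_V ::
    "(real \<Rightarrow> real) \<Rightarrow> real \<Rightarrow> real \<Rightarrow> real \<Rightarrow> real \<Rightarrow> real" where
  "external_rate_V gV \<gamma>V \<rho>V r t = gV (\<gamma>V * r + \<rho>V * t)"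

definition critical_const :: "nat \<Rightarrow> real \<Rightarrow> real \<Rightarrow> real \<Rightarrow> real \<Rightarrow> real \<Rightarrow> real" where
  "critical_const n \<beta> G \<gamma>U c \<rho>U =
     (if \<beta> < 1 / (real n - 1)
        then \<gamma>U powr (\<beta> * (real n - 1)) / (real n * G powr (- (real n - 1)))
      else if \<beta> = 1 / (real n - 1)
        then \<gamma>U / (real n * G powr (- (real n - 1)) + (c - \<rho>U))
      else \<gamma>U / (c - \<rho>U))"

end

theory Submission
  imports Defs
begin

text \<open>
  With the rates frozen, the path from \<open>U\<close> to \<open>V\<close> is a birth-death chain. A configuration that can
  be reached from \<open>U\<close> never has active nodes on both sides, and only the number of its active
  nodes influences its future. Switching off the nodes of \<open>U\<close> and then switching on those of \<open>V\<close> is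
  a walk with steps \<open>1\<close> and \<open>-1\<close> on the levels \<open>0, \<dots>, |U| + |V|\<close>. If such a walk leaves level \<open>j\<close>
  upwards at rate \<open>\<lambda>\<^sub>j\<close> and downwards at rate \<open>\<mu>\<^sub>j\<close>, its mean passage time \<open>e\<^sub>j\<close> from \<open>j\<close> to \<open>j + 1\<close>
  satisfies \<open>\<lambda>\<^sub>j e\<^sub>j = 1 + \<mu>\<^sub>j e\<^bsub>j-1\<^esub>\<close>, and the mean transition time is the sum of the \<open>e\<^sub>j\<close>
  (\<open>mean_transition_time_eq\<close>).

  Everything about the critical time is read off from this sum. It increases with the rate \<open>a\<close> of \<open>U\<close>,
  decreases in the rate \<open>b\<close> of \<open>V\<close>, is continuous for \<open>b > 0\<close>, and is at least \<open>1 / (|V| b)\<close>. As \<open>a\<close>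
  decreases and \<open>b\<close> increases with \<open>s\<close>, the function \<open>s \<nu>(s)\<close> is continuous, and strictly increasing
  where it is positive: there is exactly one critical time, and it is at most \<open>s\<close> as soon as the mean
  transition time at \<open>s\<close> is. When \<open>a\<close> and \<open>b / a\<close> tend to infinity, the sum is dominated by the
  passage from one active node of \<open>U\<close> to none and is asymptotic to \<open>a\<^sup>n\<^sup>-\<^sup>1 / n\<close> with \<open>n = |U|\<close>
  (\<open>crossing_time_asymptotics\<close>). It remains to compare this with \<open>s = \<kappa> r\<^sup>p\<close>, \<open>p = min 1 (\<beta> (n - 1))\<close>,
  for \<open>\<kappa>\<close> slightly below and slightly above the claimed constant. If \<open>\<beta> (n - 1) < 1\<close>, then \<open>s\<close> is too
  small to change the leading order of \<open>a\<close>; if \<open>\<beta> (n - 1) > 1\<close>, the mean transition time exceeds \<open>s\<close> until the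
  argument of \<open>gU\<close> is no longer of order \<open>r\<close>; in between, both effects have the same order.

  The recursion has to be derived from the construction of the process by clocks. By the
  memorylessness of the exponential law, the event that a given clock ticks first has the expected
  probability, and on this event the clocks restarted at the first tick have the original law
  (\<open>nn_integral_race\<close>). Outside a null set the first tick splits the path of the network into
  a waiting time, a jump, and a path driven by the restarted clocks (\<open>hitting_time_step\<close>). The
  hitting times truncated at the \<open>t\<close>-th tick thus obey first-step equations, and monotone
  convergence together with the bound by the sum of the \<open>e\<^sub>j\<close> yields the mean transition time.
\<close>

section \<open>Memorylessness of families of exponential variables\<close>
abbreviation std_exp :: "real measure" where
  "std_exp \<equiv> density lborel (exponential_density 1)"

abbreviation exp_seqs :: "'i set \<Rightarrow> ('i \<Rightarrow> real) measure" where
  "exp_seqs I \<equiv> PiM I (\<lambda>_. std_exp)"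

lemma prob_space_std_exp: "prob_space std_exp"
  by (rule prob_space_exponential_density) simp

lemma prob_space_exp_seqs: "prob_space (exp_seqs I)"
  by (intro prob_space_PiM prob_space_std_exp)

lemma AE_std_exp_pos: "AE x in std_exp. 0 < x"
proof -
  have "AE x in lborel. x \<noteq> (0::real)" by (rule AE_lborel_singleton)
  then show ?thesis
    by (subst AE_density) (auto simp: exponential_density_def)
qed

text \<open>
  The cases \<open>k = 0\<close> and \<open>k = 1\<close> give winning probabilities, mean waiting times and Laplace
  transforms in one computation.
\<close>
lemma nn_integral_std_exp_power_exp:
  assumes "0 \<le> c"
  shows "(\<integral>\<^sup>+x. ennreal (x ^ k * exp (- (c * x))) \<partial>std_exp) = ennreal (fact k / (1 + c) ^ Suc k)"
proof -
  define L where "L = 1 + c"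
  have L: "L > 0" using assms by (simp add: L_def)
  have "(\<integral>\<^sup>+x. ennreal (x ^ k * exp (- (c * x))) \<partial>std_exp)
      = (\<integral>\<^sup>+x. ennreal (x ^ k * exp (- (L * x))) * indicator {0..} x \<partial>lborel)"
    by (subst nn_integral_density)
       (auto intro!: nn_integral_cong split: split_indicator
         simp: exponential_density_def L_def ennreal_mult'[symmetric] algebra_simps exp_add[symmetric])
  also have "\<dots> = ennreal \<bar>1 / L\<bar> * (\<integral>\<^sup>+x. ennreal ((0 + 1 / L * x) ^ k * exp (- (L * (0 + 1 / L * x)))) * indicator {0..} (0 + 1 / L * x) \<partial>lborel)"
    using L by (subst nn_integral_real_affine[where c = "1 / L" and t = 0]) (auto simp: ac_simps)
  also have "(\<integral>\<^sup>+x. ennreal ((0 + 1 / L * x) ^ k * exp (- (L * (0 + 1 / L * x)))) * indicator {0..} (0 + 1 / L * x) \<partial>lborel)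
     = (\<integral>\<^sup>+x. ennreal ((1 / L) ^ k) * (ennreal (x ^ k * exp (- x)) * indicator {0..} x) \<partial>lborel)"
    using L by (auto intro!: nn_integral_cong split: split_indicator
        simp: power_mult_distrib power_divide ennreal_mult'[symmetric] zero_le_divide_iff)
  also have "\<dots> = ennreal ((1 / L) ^ k) * ennreal (fact k)"
    by (subst nn_integral_cmult) (auto simp: nn_intergal_power_times_exp_Ici)
  finally show ?thesis
    using L by (simp add: ennreal_mult'[symmetric] L_def[symmetric] power_divide
        ennreal_mult[symmetric])
qed

lemma nn_integral_exp_seqs_split:
  assumes "i \<in> I" and F[measurable]: "F \<in> borel_measurable (exp_seqs I)"
  shows "(\<integral>\<^sup>+X. F X \<partial>exp_seqs I) = (\<integral>\<^sup>+s. \<integral>\<^sup>+X. F (X(i := s)) \<partial>exp_seqs (I - {i}) \<partial>std_exp)"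
    and "(\<integral>\<^sup>+X. F X \<partial>exp_seqs I) = (\<integral>\<^sup>+X. \<integral>\<^sup>+s. F (X(i := s)) \<partial>std_exp \<partial>exp_seqs (I - {i}))"
    and "(\<lambda>(s, X). F (X(i := s))) \<in> borel_measurable (std_exp \<Otimes>\<^sub>M exp_seqs (I - {i}))"
proof -
  interpret E: prob_space std_exp by (rule prob_space_std_exp)
  interpret Q: prob_space "exp_seqs (I - {i})" by (rule prob_space_exp_seqs)
  interpret pair_sigma_finite std_exp "exp_seqs (I - {i})" ..
  have I: "insert i (I - {i}) = I" using assms by auto
  have up[measurable]: "(\<lambda>(x, X). X(i := x)) \<in> std_exp \<Otimes>\<^sub>M exp_seqs (I - {i}) \<rightarrow>\<^sub>M exp_seqs I"
  proof -
    have "(\<lambda>z. (snd z)(i := fst z)) \<in> std_exp \<Otimes>\<^sub>M exp_seqs (I - {i}) \<rightarrow>\<^sub>M exp_seqs I"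
      by (rule measurable_fun_upd[where J = "I - {i}"]) (use assms in auto)
    then show ?thesis by (simp add: case_prod_beta')
  qed
  have eq: "exp_seqs I = distr (std_exp \<Otimes>\<^sub>M exp_seqs (I - {i})) (exp_seqs I) (\<lambda>(x, X). X(i := x))"
    using distr_pair_PiM_eq_PiM[of "I - {i}" "\<lambda>_. std_exp" i] unfolding I
    by (simp add: prob_space_std_exp)
  show m[measurable]: "(\<lambda>(s, X). F (X(i := s))) \<in> borel_measurable (std_exp \<Otimes>\<^sub>M exp_seqs (I - {i}))"
    using measurable_compose[OF up F] by (simp add: case_prod_beta')
  have "(\<integral>\<^sup>+X. F X \<partial>exp_seqs I) = (\<integral>\<^sup>+z. (\<lambda>(s, X). F (X(i := s))) z \<partial>(std_exp \<Otimes>\<^sub>M exp_seqs (I - {i})))"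
    by (subst eq, subst nn_integral_distr) (auto simp: case_prod_beta')
  then show "(\<integral>\<^sup>+X. F X \<partial>exp_seqs I) = (\<integral>\<^sup>+s. \<integral>\<^sup>+X. F (X(i := s)) \<partial>exp_seqs (I - {i}) \<partial>std_exp)"
    and "(\<integral>\<^sup>+X. F X \<partial>exp_seqs I) = (\<integral>\<^sup>+X. \<integral>\<^sup>+s. F (X(i := s)) \<partial>std_exp \<partial>exp_seqs (I - {i}))"
    using Q.nn_integral_fst[OF m] nn_integral_snd[OF m] by simp_all
qed

lemma std_exp_memoryless:
  assumes "0 \<le> d" and [measurable]: "g \<in> borel_measurable borel"
  shows "(\<integral>\<^sup>+s. (if d < s then g (s - d) else 0) \<partial>std_exp) = ennreal (exp (- d)) * (\<integral>\<^sup>+s. g s \<partial>std_exp)"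
proof -
  have "(\<integral>\<^sup>+s. (if d < s then g (s - d) else 0) \<partial>std_exp)
      = (\<integral>\<^sup>+s. ennreal (exponential_density 1 s) * (if d < s then g (s - d) else 0) \<partial>lborel)"
    by (subst nn_integral_density) auto
  also have "\<dots> = (\<integral>\<^sup>+s. ennreal (exponential_density 1 (d + s)) * (if 0 < s then g s else 0) \<partial>lborel)"
    by (subst nn_integral_real_affine[where c = 1 and t = d]) (auto intro!: nn_integral_cong)
  also have "\<dots> = (\<integral>\<^sup>+s. ennreal (exp (- d)) * (ennreal (exponential_density 1 s) * g s) \<partial>lborel)"
    using AE_lborel_singleton[of 0] \<open>0 \<le> d\<close>
    by (intro nn_integral_cong_AE)
       (auto elim!: eventually_mono simp: exponential_density_def mult.assoc[symmetric]
         ennreal_mult'[symmetric] exp_add[symmetric] algebra_simps)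
  also have "\<dots> = ennreal (exp (- d)) * (\<integral>\<^sup>+s. g s \<partial>std_exp)"
    by (subst nn_integral_cmult, simp, subst nn_integral_density) auto
  finally show ?thesis .
qed

text \<open>
  Fubini for the splitting of one coordinate reduces this to the memorylessness of that coordinate.
\<close>
lemma exp_seqs_memoryless1:
  assumes "i \<in> I" "0 \<le> d" and [measurable]: "G \<in> borel_measurable (exp_seqs I)"
  shows "(\<integral>\<^sup>+X. (if d < X i then G (X(i := X i - d)) else 0) \<partial>exp_seqs I)
       = ennreal (exp (- d)) * (\<integral>\<^sup>+X. G X \<partial>exp_seqs I)"
proof -
  have I: "insert i (I - {i}) = I" using assms by auto
  have [measurable]: "(\<lambda>X. X(i := X i - d)) \<in> exp_seqs I \<rightarrow>\<^sub>M exp_seqs I"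
    by (rule measurable_fun_upd[where J = I]) (use assms in auto)
  have [measurable]: "(\<lambda>X. X i) \<in> borel_measurable (exp_seqs I)"
    using measurable_component_singleton[OF \<open>i \<in> I\<close>, of "\<lambda>_. std_exp"] by simp
  have m: "(\<lambda>(s, X). G (X(i := s))) \<in> borel_measurable (std_exp \<Otimes>\<^sub>M exp_seqs (I - {i}))"
    by (rule nn_integral_exp_seqs_split(3)) (use assms in auto)
  interpret E: prob_space std_exp by (rule prob_space_std_exp)
  interpret Q: prob_space "exp_seqs (I - {i})" by (rule prob_space_exp_seqs)
  interpret pair_sigma_finite std_exp "exp_seqs (I - {i})" ..
  have m': "(\<lambda>s. G (X(i := s))) \<in> borel_measurable borel" if "X \<in> space (exp_seqs (I - {i}))" for X
    using measurable_Pair1[OF m that] by simp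
  have "(\<integral>\<^sup>+X. (if d < X i then G (X(i := X i - d)) else 0) \<partial>exp_seqs I)
      = (\<integral>\<^sup>+X. \<integral>\<^sup>+s. (if d < s then G (X(i := s - d)) else 0) \<partial>std_exp \<partial>exp_seqs (I - {i}))"
    by (subst nn_integral_exp_seqs_split(2)[OF \<open>i \<in> I\<close>]) (auto simp: if_distrib cong: if_cong)
  also have "\<dots> = (\<integral>\<^sup>+X. ennreal (exp (- d)) * (\<integral>\<^sup>+s. G (X(i := s)) \<partial>std_exp) \<partial>exp_seqs (I - {i}))"
    by (intro nn_integral_cong std_exp_memoryless assms m')
  also have "\<dots> = ennreal (exp (- d)) * (\<integral>\<^sup>+X. \<integral>\<^sup>+s. G (X(i := s)) \<partial>std_exp \<partial>exp_seqs (I - {i}))"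
    by (intro nn_integral_cmult borel_measurable_nn_integral_fst) (use m in \<open>measurable\<close>)
  finally show ?thesis
    by (subst nn_integral_exp_seqs_split(2)[OF \<open>i \<in> I\<close>]) simp_all
qed

text \<open>
  The coordinates in \<open>A\<close> are killed and shifted one after the other; each step leaves the law of the
  family unchanged and costs a factor \<open>exp (- d i)\<close>.
\<close>
lemma exp_seqs_memoryless:
  assumes "finite A" "A \<subseteq> I" "\<And>i. i \<in> A \<Longrightarrow> 0 \<le> d i" and "G \<in> borel_measurable (exp_seqs I)"
  shows "(\<integral>\<^sup>+X. (if \<forall>i\<in>A. d i < X i then G (\<lambda>i\<in>I. if i \<in> A then X i - d i else X i) else 0) \<partial>exp_seqs I)
       = ennreal (exp (- (\<Sum>i\<in>A. d i))) * (\<integral>\<^sup>+X. G X \<partial>exp_seqs I)"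
  using assms
proof (induction A rule: finite_induct)
  case empty
  have "(\<integral>\<^sup>+X. G (restrict X I) \<partial>exp_seqs I) = (\<integral>\<^sup>+X. G X \<partial>exp_seqs I)"
    by (intro nn_integral_cong) (auto simp: space_PiM)
  then show ?case by simp
next
  case (insert a A)
  have [measurable]: "G \<in> borel_measurable (exp_seqs I)" by fact
  have AI: "A \<subseteq> I" "a \<in> I" using insert by auto
  have [measurable]: "(\<lambda>X. X i) \<in> borel_measurable (exp_seqs I)" if "i \<in> I" for i
    using measurable_component_singleton[OF that, of "\<lambda>_. std_exp"] by simp
  have [measurable]: "(\<lambda>X. \<lambda>i\<in>I. if i \<in> A then X i - d i else X i) \<in> exp_seqs I \<rightarrow>\<^sub>M exp_seqs I"
    by (rule measurable_restrict) auto
  define H where "H X = (if \<forall>i\<in>A. d i < X i then G (\<lambda>i\<in>I. if i \<in> A then X i - d i else X i) else 0)" for X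
  have [measurable]: "Measurable.pred (exp_seqs I) (\<lambda>X. \<forall>i\<in>A. d i < X i)"
    using AI \<open>finite A\<close> by (intro pred_intros_finite) auto
  have "H \<in> borel_measurable (exp_seqs I)"
    unfolding H_def by measurable
  then have "(\<integral>\<^sup>+X. (if d a < X a then H (X(a := X a - d a)) else 0) \<partial>exp_seqs I)
       = ennreal (exp (- d a)) * (\<integral>\<^sup>+X. H X \<partial>exp_seqs I)"
    using insert AI by (intro exp_seqs_memoryless1) auto
  also have "(\<integral>\<^sup>+X. H X \<partial>exp_seqs I) = ennreal (exp (- (\<Sum>i\<in>A. d i))) * (\<integral>\<^sup>+X. G X \<partial>exp_seqs I)"
    unfolding H_def using insert by auto
  also have "(\<lambda>X. if d a < X a then H (X(a := X a - d a)) else 0) =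
     (\<lambda>X. if \<forall>i\<in>insert a A. d i < X i then G (\<lambda>i\<in>I. if i \<in> insert a A then X i - d i else X i) else 0)"
  proof
    fix X
    have "(\<forall>i\<in>A. d i < (X(a := X a - d a)) i) = (\<forall>i\<in>A. d i < X i)"
      using insert(2) by auto
    moreover have "(\<lambda>i\<in>I. if i \<in> A then (X(a := X a - d a)) i - d i else (X(a := X a - d a)) i)
       = (\<lambda>i\<in>I. if i \<in> insert a A then X i - d i else X i)"
      using insert(2) by (auto simp: restrict_def)
    ultimately show "(if d a < X a then H (X(a := X a - d a)) else 0) =
     (if \<forall>i\<in>insert a A. d i < X i then G (\<lambda>i\<in>I. if i \<in> insert a A then X i - d i else X i) else 0)"
      unfolding H_def by simp
  qed
  also have "ennreal (exp (- d a)) * (ennreal (exp (- (\<Sum>i\<in>A. d i))) * (\<integral>\<^sup>+X. G X \<partial>exp_seqs I))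
      = ennreal (exp (- (\<Sum>i\<in>insert a A. d i))) * (\<integral>\<^sup>+X. G X \<partial>exp_seqs I)"
    using insert(1,2) by (simp add: mult.assoc[symmetric] ennreal_mult[symmetric] exp_add[symmetric])
  finally show ?case .
qed

lemma exp_seqs_reindex:
  assumes "inj_on f J" "f \<in> J \<rightarrow> I" and [measurable]: "F \<in> borel_measurable (exp_seqs J)"
  shows "(\<integral>\<^sup>+X. F (\<lambda>n\<in>J. X (f n)) \<partial>exp_seqs I) = (\<integral>\<^sup>+X. F X \<partial>exp_seqs J)"
proof -
  have [measurable]: "(\<lambda>X. \<lambda>n\<in>J. X (f n)) \<in> exp_seqs I \<rightarrow>\<^sub>M exp_seqs J"
    by (rule measurable_restrict)
       (use assms in \<open>auto intro: measurable_component_singleton[of _ _ "\<lambda>_. std_exp", simplified]\<close>)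
  have "exp_seqs J = distr (exp_seqs I) (exp_seqs J) (\<lambda>X. \<lambda>n\<in>J. X (f n))"
    using distr_PiM_reindex[of I "\<lambda>_. std_exp" f J] assms prob_space_std_exp by simp
  then have "(\<integral>\<^sup>+X. F X \<partial>exp_seqs J) = (\<integral>\<^sup>+X. F X \<partial>distr (exp_seqs I) (exp_seqs J) (\<lambda>X. \<lambda>n\<in>J. X (f n)))"
    by simp
  also have "\<dots> = (\<integral>\<^sup>+X. F (\<lambda>n\<in>J. X (f n)) \<partial>exp_seqs I)"
    by (subst nn_integral_distr) auto
  finally show ?thesis by simp
qed

section \<open>The first tick of competing clocks\<close>
text \<open>
  Clock \<open>k\<close> first ticks at time \<open>\<omega> (k, 0) / q k\<close>. The comparison with the other clocks is
  multiplied out by their rates, so that a clock of rate \<open>0\<close>, which never ticks, loses against every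
  ticking clock as soon as its variables are positive.
\<close>
definition wins :: "'k set \<Rightarrow> ('k \<Rightarrow> real) \<Rightarrow> 'k \<Rightarrow> ('k \<times> nat \<Rightarrow> real) \<Rightarrow> bool" where
  "wins K q k \<omega> \<longleftrightarrow> (\<forall>j\<in>K - {k}. q j / q k * \<omega> (k, 0) < \<omega> (j, 0))"

text \<open>
  The clocks seen from the first tick of clock \<open>k\<close>: clock \<open>k\<close> moves on to its next gap, and the
  running gap of every other clock is shortened by the elapsed time, measured in its own rate.
\<close>
definition restart :: "'k set \<Rightarrow> ('k \<Rightarrow> real) \<Rightarrow> 'k \<Rightarrow> ('k \<times> nat \<Rightarrow> real) \<Rightarrow> 'k \<times> nat \<Rightarrow> real" where
  "restart K q k \<omega> = (\<lambda>(j, m)\<in>K \<times> UNIV.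
     if j = k then \<omega> (k, Suc m)
     else if m = 0 then \<omega> (j, 0) - q j / q k * \<omega> (k, 0) else \<omega> (j, m))"

locale clock_race =
  fixes K :: "'k set" and q :: "'k \<Rightarrow> real"
  assumes finite_K: "finite K" and rate_nonneg: "\<And>k. k \<in> K \<Longrightarrow> 0 \<le> q k"
    and total_pos: "0 < sum q K"
begin

abbreviation "\<Omega> \<equiv> exp_seqs (K \<times> (UNIV :: nat set))"
abbreviation "R \<equiv> sum q K"
abbreviation "Kp \<equiv> {k \<in> K. 0 < q k}"

lemma component_measurable[measurable]:
  "k \<in> K \<Longrightarrow> (\<lambda>\<omega>. \<omega> (k, m)) \<in> borel_measurable \<Omega>"
  using measurable_component_singleton[of "(k, m)" "K \<times> UNIV" "\<lambda>_. std_exp"] by simp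

lemma restart_measurable[measurable]:
  assumes "k \<in> K" shows "restart K q k \<in> \<Omega> \<rightarrow>\<^sub>M \<Omega>"
  unfolding restart_def case_prod_beta'
proof (rule measurable_restrict)
  fix jm assume "jm \<in> K \<times> (UNIV :: nat set)"
  then have [measurable]: "fst jm \<in> K" and [measurable]: "k \<in> K" using assms by auto
  show "(\<lambda>\<omega>. if fst jm = k then \<omega> (k, Suc (snd jm))
     else if snd jm = 0 then \<omega> (fst jm, 0) - q (fst jm) / q k * \<omega> (k, 0) else \<omega> (fst jm, snd jm))
     \<in> \<Omega> \<rightarrow>\<^sub>M std_exp" 
    by simp
qed

lemma wins_measurable[measurable]:
  assumes "k \<in> K" shows "Measurable.pred \<Omega> (wins K q k)"
  unfolding wins_def using assms finite_K by (intro pred_intros_finite) auto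

text \<open>
  Given \<open>\<omega> (k, 0) = s\<close>, each other clock \<open>j\<close> survives until time \<open>s / q k\<close> with probability
  \<open>exp (- (q j / q k) s)\<close>, and by memorylessness what remains of it is a fresh exponential variable.
  The product of these factors is the exponential on the right; shifting the indices of clock \<open>k\<close>
  only renames independent coordinates.
\<close>
theorem nn_integral_race:
  assumes k: "k \<in> K" "0 < q k" and [measurable]: "\<phi> \<in> borel_measurable borel"
    and F[measurable]: "F \<in> borel_measurable \<Omega>"
  shows "(\<integral>\<^sup>+\<omega>. (if wins K q k \<omega> then \<phi> (\<omega> (k, 0)) * F (restart K q k \<omega>) else 0) \<partial>\<Omega>)
       = (\<integral>\<^sup>+s. \<phi> s * ennreal (exp (- ((R / q k - 1) * s))) \<partial>std_exp) * (\<integral>\<^sup>+\<omega>. F \<omega> \<partial>\<Omega>)"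
proof -
  have [measurable]: "k \<in> K" by fact
  define I where "I = K \<times> (UNIV :: nat set) - {(k, 0)}"
  define A where "A = (K - {k}) \<times> {0::nat}"
  have A: "finite A" "A \<subseteq> I" using finite_K by (auto simp: A_def I_def)
  \<comment> \<open>\<open>f\<close> renames the coordinates that are left after \<open>(k, 0)\<close> has been integrated out.\<close>
  define f where "f = (\<lambda>(j, m). if j = k then (k, Suc m) else (j, m))"
  have f: "inj_on f (K \<times> UNIV)" "f \<in> K \<times> UNIV \<rightarrow> I"
    using k by (auto simp: f_def I_def inj_on_def split: if_splits)
  define G where "G X = F (\<lambda>n\<in>K \<times> UNIV. X (f n))" for X
  have [measurable]: "(\<lambda>X. \<lambda>n\<in>K \<times> UNIV. X (f n)) \<in> exp_seqs I \<rightarrow>\<^sub>M \<Omega>"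
    by (rule measurable_restrict)
       (use f in \<open>auto intro!: measurable_component_singleton[of _ _ "\<lambda>_. std_exp", simplified]\<close>)
  have G[measurable]: "G \<in> borel_measurable (exp_seqs I)" unfolding G_def by measurable
  have "(\<integral>\<^sup>+\<omega>. (if wins K q k \<omega> then \<phi> (\<omega> (k, 0)) * F (restart K q k \<omega>) else 0) \<partial>\<Omega>)
      = (\<integral>\<^sup>+s. \<integral>\<^sup>+X. (if wins K q k (X((k, 0) := s))
           then \<phi> s * F (restart K q k (X((k, 0) := s))) else 0) \<partial>exp_seqs I \<partial>std_exp)"
    unfolding I_def using k
    by (subst nn_integral_exp_seqs_split(1)[of "(k, 0)"]) (auto intro!: nn_integral_cong)
  also have "\<dots> = (\<integral>\<^sup>+s. \<phi> s * ennreal (exp (- ((R / q k - 1) * s))) * (\<integral>\<^sup>+\<omega>. F \<omega> \<partial>\<Omega>) \<partial>std_exp)"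
    using AE_std_exp_pos
  proof (intro nn_integral_cong_AE, elim eventually_mono)
    fix s :: real assume "0 < s"
    define d where "d jm = q (fst jm) / q k * s" for jm :: "'k \<times> nat"
    have d: "0 \<le> d i" if "i \<in> A" for i
      using that k \<open>0 < s\<close> rate_nonneg by (auto simp: d_def A_def)
    have sd: "(\<Sum>i\<in>A. d i) = (R / q k - 1) * s"
    proof -
      have "(\<Sum>i\<in>A. d i) = (\<Sum>j\<in>K - {k}. q j / q k * s)"
        unfolding A_def d_def by (rule sum.reindex_bij_witness[of _ "\<lambda>j. (j, 0)" fst]) auto
      also have "\<dots> = (\<Sum>j\<in>K - {k}. q j) * (s / q k)"
        by (simp add: sum_distrib_right sum_divide_distrib)
      also have "(\<Sum>j\<in>K - {k}. q j) = R - q k"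
        using k finite_K by (simp add: sum_diff1)
      finally show ?thesis using k by (simp add: field_simps)
    qed
    have "(\<integral>\<^sup>+X. (if wins K q k (X((k, 0) := s)) then \<phi> s * F (restart K q k (X((k, 0) := s))) else 0) \<partial>exp_seqs I)
        = (\<integral>\<^sup>+X. \<phi> s * (if \<forall>i\<in>A. d i < X i then G (\<lambda>i\<in>I. if i \<in> A then X i - d i else X i) else 0) \<partial>exp_seqs I)"
    proof (intro nn_integral_cong)
      fix X :: "'k \<times> nat \<Rightarrow> real"
      have 1: "wins K q k (X((k, 0) := s)) \<longleftrightarrow> (\<forall>i\<in>A. d i < X i)"
        by (auto simp: wins_def A_def d_def)
      have 2: "restart K q k (X((k, 0) := s))
          = (\<lambda>n\<in>K \<times> UNIV. (\<lambda>i\<in>I. if i \<in> A then X i - d i else X i) (f n))"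
        using k by (auto simp: restart_def fun_eq_iff I_def A_def d_def f_def)
      show "(if wins K q k (X((k, 0) := s)) then \<phi> s * F (restart K q k (X((k, 0) := s))) else 0)
         = \<phi> s * (if \<forall>i\<in>A. d i < X i then G (\<lambda>i\<in>I. if i \<in> A then X i - d i else X i) else 0)"
        unfolding 1 2 G_def by simp
    qed
    also have "\<dots> = \<phi> s * (\<integral>\<^sup>+X. (if \<forall>i\<in>A. d i < X i then G (\<lambda>i\<in>I. if i \<in> A then X i - d i else X i) else 0) \<partial>exp_seqs I)"
    proof (rule nn_integral_cmult)
      have [measurable]: "(\<lambda>X. X i) \<in> borel_measurable (exp_seqs I)" if "i \<in> I" for i
        using measurable_component_singleton[OF that, of "\<lambda>_. std_exp"] by simp
      have [measurable]: "(\<lambda>X. \<lambda>i\<in>I. if i \<in> A then X i - d i else X i) \<in> exp_seqs I \<rightarrow>\<^sub>M exp_seqs I"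
        by (rule measurable_restrict) auto
      have [measurable]: "Measurable.pred (exp_seqs I) (\<lambda>X. \<forall>i\<in>A. d i < X i)"
        using A by (intro pred_intros_finite) auto
      show "(\<lambda>X. if \<forall>i\<in>A. d i < X i then G (\<lambda>i\<in>I. if i \<in> A then X i - d i else X i) else 0)
          \<in> borel_measurable (exp_seqs I)"
        by measurable
    qed
    also have "\<dots> = \<phi> s * (ennreal (exp (- ((R / q k - 1) * s))) * (\<integral>\<^sup>+X. G X \<partial>exp_seqs I))"
      by (subst exp_seqs_memoryless[OF A d G]) (simp_all add: sd)
    also have "(\<integral>\<^sup>+X. G X \<partial>exp_seqs I) = (\<integral>\<^sup>+\<omega>. F \<omega> \<partial>\<Omega>)"
      unfolding G_def by (rule exp_seqs_reindex[OF f F])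
    finally show "(\<integral>\<^sup>+X. (if wins K q k (X((k, 0) := s)) then \<phi> s * F (restart K q k (X((k, 0) := s))) else 0) \<partial>exp_seqs I)
        = \<phi> s * ennreal (exp (- ((R / q k - 1) * s))) * (\<integral>\<^sup>+\<omega>. F \<omega> \<partial>\<Omega>)"
      by (simp only: mult.assoc)
  qed
  also have "\<dots> = (\<integral>\<^sup>+s. \<phi> s * ennreal (exp (- ((R / q k - 1) * s))) \<partial>std_exp) * (\<integral>\<^sup>+\<omega>. F \<omega> \<partial>\<Omega>)"
    by (rule nn_integral_multc) simp
  finally show ?thesis .
qed

lemma nn_integral_race_power_exp:
  assumes k: "k \<in> K" "0 < q k" and c: "0 \<le> c" and F: "F \<in> borel_measurable \<Omega>"
  shows "(\<integral>\<^sup>+\<omega>. (if wins K q k \<omega>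
             then ennreal ((\<omega> (k, 0) / q k) ^ n * exp (- (c * (\<omega> (k, 0) / q k)))) * F (restart K q k \<omega>) else 0) \<partial>\<Omega>)
       = ennreal (fact n * q k / (R + c) ^ Suc n) * (\<integral>\<^sup>+\<omega>. F \<omega> \<partial>\<Omega>)"
proof -
  have le: "q k \<le> R" using k finite_K rate_nonneg by (intro member_le_sum) auto
  have ex: "exp (- (c * s / q k)) * exp (- ((R / q k - 1) * s)) = exp (- (((R + c) / q k - 1) * s))" for s
    unfolding exp_add[symmetric] using k by (simp add: field_simps)
  have "(\<integral>\<^sup>+s. ennreal ((s / q k) ^ n * exp (- (c * (s / q k)))) * ennreal (exp (- ((R / q k - 1) * s))) \<partial>std_exp)
     = (\<integral>\<^sup>+s. ennreal ((1 / q k) ^ n) * ennreal (s ^ n * exp (- (((R + c) / q k - 1) * s))) \<partial>std_exp)"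
    using k by (intro nn_integral_cong)
      (simp add: ennreal_mult'[symmetric] ennreal_mult''[symmetric] power_divide mult.assoc ex
        del: minus_mult_left)
  also have "\<dots> = ennreal ((1 / q k) ^ n) * ennreal (fact n / (1 + ((R + c) / q k - 1)) ^ Suc n)"
    using le k c by (subst nn_integral_cmult, simp, subst nn_integral_std_exp_power_exp) (auto simp: field_simps)
  also have "\<dots> = ennreal (fact n * q k / (R + c) ^ Suc n)"
    using k total_pos c by (subst ennreal_mult'[symmetric]) (auto simp: field_simps power_divide)
  finally show ?thesis
    by (subst nn_integral_race[OF k _ F, of "\<lambda>s. ennreal ((s / q k) ^ n * exp (- (c * (s / q k))))"]) simp_all
qed

lemma emeasure_wins:
  assumes k: "k \<in> K" "0 < q k"
  shows "emeasure \<Omega> {\<omega>\<in>space \<Omega>. wins K q k \<omega>} = ennreal (q k / R)"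
proof -
  interpret prob_space \<Omega> by (rule prob_space_exp_seqs)
  note [measurable] = k(1)
  have "emeasure \<Omega> {\<omega>\<in>space \<Omega>. wins K q k \<omega>} = (\<integral>\<^sup>+\<omega>. indicator {\<omega>\<in>space \<Omega>. wins K q k \<omega>} \<omega> \<partial>\<Omega>)"
    by simp
  also have "\<dots> = (\<integral>\<^sup>+\<omega>. (if wins K q k \<omega>
             then ennreal ((\<omega> (k, 0) / q k) ^ 0 * exp (- (0 * (\<omega> (k, 0) / q k)))) * (\<lambda>_. 1) (restart K q k \<omega>) else 0) \<partial>\<Omega>)"
    by (intro nn_integral_cong) (auto split: split_indicator)
  also have "\<dots> = ennreal (q k / R)"
    by (subst nn_integral_race_power_exp[OF k]) (simp_all add: emeasure_space_1)
  finally show ?thesis .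
qed

text \<open>
  Restarting maps the part of the space where \<open>k\<close> wins to a multiple of the original law, hence
  pulls null sets back to null sets.
\<close>
lemma AE_restart:
  assumes "AE \<omega> in \<Omega>. P \<omega>" and k: "k \<in> K" "0 < q k"
  shows "AE \<omega> in \<Omega>. wins K q k \<omega> \<longrightarrow> P (restart K q k \<omega>)"
proof -
  note [measurable] = k(1)
  obtain N where N: "{\<omega>\<in>space \<Omega>. \<not> P \<omega>} \<subseteq> N" "emeasure \<Omega> N = 0" and [measurable]: "N \<in> sets \<Omega>"
    using assms(1) by (auto elim!: AE_E)
  have "(\<integral>\<^sup>+\<omega>. (if wins K q k \<omega>
             then ennreal ((\<omega> (k, 0) / q k) ^ 0 * exp (- (0 * (\<omega> (k, 0) / q k)))) * indicator N (restart K q k \<omega>) else 0) \<partial>\<Omega>) = 0"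
    by (subst nn_integral_race_power_exp[OF k]) (simp_all add: N)
  then have "AE \<omega> in \<Omega>. (if wins K q k \<omega>
             then ennreal ((\<omega> (k, 0) / q k) ^ 0 * exp (- (0 * (\<omega> (k, 0) / q k)))) * indicator N (restart K q k \<omega>) else 0) = (0::ennreal)"
    by (subst (asm) nn_integral_0_iff_AE) auto
  with AE_space show ?thesis
  proof eventually_elim
    case (elim \<omega>)
    have "restart K q k \<omega> \<in> space \<Omega>" using elim(1) measurable_space[OF restart_measurable[OF k(1)]] by auto
    with elim(2) N(1) show ?case by (auto split: split_indicator_asm if_splits)
  qed
qed

lemma AE_pos: "AE \<omega> in \<Omega>. \<forall>k\<in>K. \<forall>m. 0 < \<omega> (k, m)"
  using finite_K
  by (auto simp: AE_finite_all AE_all_countable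
      intro!: AE_PiM_component[where P = "\<lambda>x. 0 < x"] prob_space_std_exp AE_std_exp_pos)

lemma wins_unique:
  assumes "k \<in> Kp" "j \<in> Kp" "wins K q k \<omega>" "wins K q j \<omega>"
  shows "k = j"
proof (rule ccontr)
  assume "k \<noteq> j"
  then have "q j / q k * \<omega> (k, 0) < \<omega> (j, 0)" "q k / q j * \<omega> (j, 0) < \<omega> (k, 0)"
    using assms by (auto simp: wins_def)
  then have "q j * \<omega> (k, 0) < q k * \<omega> (j, 0)" "q k * \<omega> (j, 0) < q j * \<omega> (k, 0)"
    using assms by (auto simp: field_simps)
  then show False by simp
qed

lemma sum_Kp: "(\<Sum>k\<in>Kp. q k) = R"
  by (rule sum.mono_neutral_left) (use finite_K rate_nonneg in \<open>force+\<close>)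

text \<open>
  The winning events are disjoint and their probabilities \<open>q k / R\<close> add up to \<open>1\<close>, so ties have
  probability \<open>0\<close>.
\<close>
lemma AE_winner: "AE \<omega> in \<Omega>. \<exists>k\<in>Kp. wins K q k \<omega>"
proof -
  interpret prob_space \<Omega> by (rule prob_space_exp_seqs)
  let ?W = "\<lambda>k. {\<omega>\<in>space \<Omega>. wins K q k \<omega>}"
  have W: "?W k \<in> sets \<Omega>" if "k \<in> Kp" for k
    using wins_measurable[of k] that by (auto simp: pred_def)
  have "emeasure \<Omega> (\<Union>k\<in>Kp. ?W k) = (\<Sum>k\<in>Kp. emeasure \<Omega> (?W k))"
    using finite_K W wins_unique by (intro sum_emeasure[symmetric]) (auto simp: disjoint_family_on_def)
  also have "\<dots> = (\<Sum>k\<in>Kp. ennreal (q k / R))"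
    by (intro sum.cong) (auto simp: emeasure_wins)
  also have "\<dots> = ennreal (\<Sum>k\<in>Kp. q k / R)"
    using total_pos by (intro sum_ennreal) auto
  also have "(\<Sum>k\<in>Kp. q k / R) = 1"
    using total_pos sum_Kp by (simp add: sum_divide_distrib[symmetric])
  finally have "AE \<omega> in \<Omega>. \<omega> \<in> (\<Union>k\<in>Kp. ?W k)"
    using W finite_K by (intro iffD1[OF prob_eq_1]) (auto simp: emeasure_eq_measure)
  then show ?thesis by eventually_elim auto
qed

end

section \<open>Successive ticks do not accumulate\<close>
context clock_race begin

definition winner :: "('k \<times> nat \<Rightarrow> real) \<Rightarrow> 'k" where
  "winner \<omega> = (THE k. k \<in> Kp \<and> wins K q k \<omega>)"

definition gap :: "('k \<times> nat \<Rightarrow> real) \<Rightarrow> real" where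
  "gap \<omega> = \<omega> (winner \<omega>, 0) / q (winner \<omega>)"

definition step :: "('k \<times> nat \<Rightarrow> real) \<Rightarrow> 'k \<times> nat \<Rightarrow> real" where
  "step \<omega> = restart K q (winner \<omega>) \<omega>"

definition regular :: "('k \<times> nat \<Rightarrow> real) \<Rightarrow> bool" where
  "regular \<omega> \<longleftrightarrow> (\<forall>k\<in>K. \<forall>m. 0 < \<omega> (k, m)) \<and> (\<exists>k\<in>Kp. wins K q k \<omega>)"

text \<open>
  The time of the \<open>n\<close>-th tick among all clocks.
\<close>
fun race_time :: "nat \<Rightarrow> ('k \<times> nat \<Rightarrow> real) \<Rightarrow> real" where
  "race_time 0 \<omega> = 0"
| "race_time (Suc n) \<omega> = gap \<omega> + race_time n (step \<omega>)"

text \<open>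
  The almost sure properties on which the analysis of single paths rests. The definition refers to
  all restarted clocks, so it is inherited by \<open>step \<omega>\<close>.
\<close>
definition good :: "('k \<times> nat \<Rightarrow> real) \<Rightarrow> bool" where
  "good \<omega> \<longleftrightarrow> (\<forall>n. regular ((step ^^ n) \<omega>)) \<and> (\<forall>t. \<exists>n. t < race_time n \<omega>)"

lemma winner_eq: "k \<in> Kp \<Longrightarrow> wins K q k \<omega> \<Longrightarrow> winner \<omega> = k"
  unfolding winner_def by (rule the_equality) (simp, rule wins_unique, simp_all)

lemma winner_in:
  assumes "regular \<omega>" shows "winner \<omega> \<in> Kp" "wins K q (winner \<omega>) \<omega>"
proof -
  obtain k where k: "k \<in> Kp" "wins K q k \<omega>" using assms unfolding regular_def by blast
  then show "winner \<omega> \<in> Kp" "wins K q (winner \<omega>) \<omega>" using winner_eq[OF k] by simp_all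
qed

lemma gap_pos: assumes "regular \<omega>" shows "0 < gap \<omega>"
proof -
  have "winner \<omega> \<in> K" "0 < q (winner \<omega>)" using winner_in(1)[OF assms] by simp_all
  then show ?thesis using assms by (simp add: gap_def regular_def)
qed

lemma good_regular: assumes "good \<omega>" shows "regular \<omega>"
proof -
  have "regular ((step ^^ 0) \<omega>)" using assms unfolding good_def by blast
  then show ?thesis by simp
qed

lemma good_step: assumes "good \<omega>" shows "good (step \<omega>)"
proof -
  have "regular ((step ^^ n) (step \<omega>))" for n
  proof -
    have "regular ((step ^^ Suc n) \<omega>)" using assms unfolding good_def by blast
    then show ?thesis unfolding funpow_Suc_right comp_apply .
  qed
  moreover have "\<exists>n. t < race_time n (step \<omega>)" for t
  proof -
    obtain n where n: "max 0 (gap \<omega> + t) < race_time n \<omega>" using assms unfolding good_def by blast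
    then obtain m where "n = Suc m" by (cases n) auto
    with n have "t < race_time m (step \<omega>)" by simp
    then show ?thesis ..
  qed
  ultimately show ?thesis by (simp add: good_def)
qed

lemma winner_sum:
  assumes "regular \<omega>"
  shows "(\<Sum>k\<in>Kp. if wins K q k \<omega> then f k else 0) = (f (winner \<omega>) :: 'b :: comm_monoid_add)"
proof -
  have "(\<Sum>k\<in>Kp. if wins K q k \<omega> then f k else 0) = (\<Sum>k\<in>Kp. if k = winner \<omega> then f k else 0)"
  proof (intro sum.cong refl if_cong)
    fix k assume "k \<in> Kp"
    then show "wins K q k \<omega> \<longleftrightarrow> k = winner \<omega>"
      using winner_in(2)[OF assms] winner_eq[of k \<omega>] by blast
  qed
  also have "\<dots> = f (winner \<omega>)"
    using winner_in(1)[OF assms] finite_K by (simp add: sum.delta)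
  finally show ?thesis .
qed

lemma AE_step:
  assumes "AE \<omega> in \<Omega>. P \<omega>" shows "AE \<omega> in \<Omega>. P (step \<omega>)"
proof -
  have "AE \<omega> in \<Omega>. \<forall>k\<in>Kp. wins K q k \<omega> \<longrightarrow> P (restart K q k \<omega>)"
  proof (rule AE_finite_allI)
    fix k assume "k \<in> Kp"
    then show "AE \<omega> in \<Omega>. wins K q k \<omega> \<longrightarrow> P (restart K q k \<omega>)"
      by (intro AE_restart[OF assms]) simp_all
  qed (use finite_K in simp)
  with AE_winner show ?thesis
  proof eventually_elim
    case (elim \<omega>)
    from elim(1) obtain k where "k \<in> Kp" "wins K q k \<omega>" by blast
    with elim(2) winner_eq[OF this] show ?case by (simp add: step_def)
  qed
qed

lemma AE_regular_steps: "AE \<omega> in \<Omega>. \<forall>n. regular ((step ^^ n) \<omega>)"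
proof (subst AE_all_countable, rule allI)
  fix n show "AE \<omega> in \<Omega>. regular ((step ^^ n) \<omega>)"
  proof (induction n)
    case 0
    show ?case using AE_pos AE_winner by eventually_elim (auto simp: regular_def)
  next
    case (Suc n)
    from AE_step[OF Suc] show ?case unfolding funpow_Suc_right comp_apply .
  qed
qed

text \<open>
  Equal to \<open>exp (- race_time n \<omega>)\<close> almost everywhere. This form refers to the finitely many maps
  \<open>restart K q k\<close> instead of \<open>step\<close> and is measurable term by term.
\<close>
fun race_laplace :: "nat \<Rightarrow> ('k \<times> nat \<Rightarrow> real) \<Rightarrow> ennreal" where
  "race_laplace 0 \<omega> = 1"
| "race_laplace (Suc n) \<omega> = (\<Sum>k\<in>Kp. if wins K q k \<omega>
     then ennreal (exp (- (\<omega> (k, 0) / q k))) * race_laplace n (restart K q k \<omega>) else 0)"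

lemma race_laplace_measurable[measurable]: "race_laplace n \<in> borel_measurable \<Omega>"
proof (induction n)
  case 0
  then show ?case by (simp cong: measurable_cong)
next
  case (Suc n)
  have [measurable]: "race_laplace n \<in> borel_measurable \<Omega>" by fact
  have "(\<lambda>\<omega>. race_laplace (Suc n) \<omega>) \<in> borel_measurable \<Omega>"
    unfolding race_laplace.simps
  proof (intro borel_measurable_sum)
    fix k assume "k \<in> Kp"
    then have [measurable]: "k \<in> K" by simp
    show "(\<lambda>\<omega>. if wins K q k \<omega>
     then ennreal (exp (- (\<omega> (k, 0) / q k))) * race_laplace n (restart K q k \<omega>) else 0) \<in> borel_measurable \<Omega>"
      by measurable
  qed
  then show ?case .
qed

lemma race_laplace_eq:
  "(\<And>m. regular ((step ^^ m) \<omega>)) \<Longrightarrow> race_laplace n \<omega> = ennreal (exp (- race_time n \<omega>))"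
proof (induction n arbitrary: \<omega>)
  case (Suc n)
  have "regular \<omega>" using Suc(2)[of 0] by simp
  have "regular ((step ^^ m) (step \<omega>))" for m
    using Suc(2)[of "Suc m"] unfolding funpow_Suc_right comp_apply .
  note IH = Suc(1)[OF this]
  have "race_laplace (Suc n) \<omega> = ennreal (exp (- gap \<omega>)) * race_laplace n (step \<omega>)"
    unfolding race_laplace.simps winner_sum[OF \<open>regular \<omega>\<close>] gap_def step_def ..
  then show ?case
    by (simp add: IH ennreal_mult[symmetric] exp_add[symmetric])
qed simp

lemma nn_integral_race_laplace: "(\<integral>\<^sup>+\<omega>. race_laplace n \<omega> \<partial>\<Omega>) = ennreal ((R / (R + 1)) ^ n)"
proof (induction n)
  case 0
  interpret prob_space \<Omega> by (rule prob_space_exp_seqs)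
  show ?case by (simp add: emeasure_space_1)
next
  case (Suc n)
  have "(\<integral>\<^sup>+\<omega>. race_laplace (Suc n) \<omega> \<partial>\<Omega>) = (\<Sum>k\<in>Kp. \<integral>\<^sup>+\<omega>. (if wins K q k \<omega>
     then ennreal (exp (- (\<omega> (k, 0) / q k))) * race_laplace n (restart K q k \<omega>) else 0) \<partial>\<Omega>)"
    unfolding race_laplace.simps
  proof (intro nn_integral_sum)
    fix k assume "k \<in> Kp"
    then have [measurable]: "k \<in> K" by simp
    show "(\<lambda>\<omega>. if wins K q k \<omega>
     then ennreal (exp (- (\<omega> (k, 0) / q k))) * race_laplace n (restart K q k \<omega>) else 0) \<in> borel_measurable \<Omega>"
      by measurable
  qed
  also have "\<dots> = (\<Sum>k\<in>Kp. ennreal (q k / (R + 1)) * ennreal ((R / (R + 1)) ^ n))"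
  proof (intro sum.cong refl)
    fix k assume "k \<in> Kp"
    then show "(\<integral>\<^sup>+\<omega>. (if wins K q k \<omega>
     then ennreal (exp (- (\<omega> (k, 0) / q k))) * race_laplace n (restart K q k \<omega>) else 0) \<partial>\<Omega>)
     = ennreal (q k / (R + 1)) * ennreal ((R / (R + 1)) ^ n)"
      using nn_integral_race_power_exp[of k 1 "race_laplace n" 0] by (simp add: Suc cong: if_cong)
  qed
  also have "\<dots> = (\<Sum>k\<in>Kp. ennreal (q k / (R + 1))) * ennreal ((R / (R + 1)) ^ n)"
    by (simp add: sum_distrib_right)
  also have "(\<Sum>k\<in>Kp. ennreal (q k / (R + 1))) = ennreal (\<Sum>k\<in>Kp. q k / (R + 1))"
    using total_pos by (intro sum_ennreal) auto
  also have "(\<Sum>k\<in>Kp. q k / (R + 1)) = R / (R + 1)"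
    using sum_Kp by (simp add: sum_divide_distrib[symmetric])
  finally show ?case using total_pos by (simp add: ennreal_mult'[symmetric])
qed

text \<open>
  Since \<open>exp (- race_time n)\<close> has mean \<open>(R / (R + 1)) ^ n\<close>, which tends to \<open>0\<close>, its infimum over \<open>n\<close>
  vanishes almost everywhere.
\<close>
lemma AE_good: "AE \<omega> in \<Omega>. good \<omega>"
proof -
  have "(\<integral>\<^sup>+\<omega>. (INF n. race_laplace n \<omega>) \<partial>\<Omega>) \<le> ennreal ((R / (R + 1)) ^ n)" for n
    unfolding nn_integral_race_laplace[symmetric] by (intro nn_integral_mono INF_lower) auto
  moreover have "(\<lambda>n. ennreal ((R / (R + 1)) ^ n)) \<longlonglongrightarrow> ennreal 0"
    using total_pos by (intro tendsto_ennrealI LIMSEQ_power_zero) auto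
  ultimately have "(\<integral>\<^sup>+\<omega>. (INF n. race_laplace n \<omega>) \<partial>\<Omega>) \<le> 0"
    by (intro LIMSEQ_le_const) auto
  then have "AE \<omega> in \<Omega>. (INF n. race_laplace n \<omega>) = 0"
    by (subst (asm) le_zero_eq, subst (asm) nn_integral_0_iff_AE) auto
  with AE_regular_steps show ?thesis
  proof eventually_elim
    case (elim \<omega>)
    have "\<exists>n. t < race_time n \<omega>" for t
    proof -
      have "(INF n. race_laplace n \<omega>) < ennreal (exp (- t))" using elim by simp
      then obtain n where "race_laplace n \<omega> < ennreal (exp (- t))" by (auto simp: INF_less_iff)
      then have "t < race_time n \<omega>" using elim by (auto simp: race_laplace_eq ennreal_less_iff)
      then show ?thesis ..
    qed
    with elim show ?case by (auto simp: good_def)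
  qed
qed

end

section \<open>Decomposition of a path at the first tick\<close>
lemma sorted_list_of_set_insert_shift:
  fixes T :: real
  assumes "finite B" "\<And>s. s \<in> B \<Longrightarrow> 0 < s"
  shows "sorted_list_of_set (insert T ((+) T ` B)) = T # map ((+) T) (sorted_list_of_set B)"
proof -
  have "sorted_wrt (<) (map ((+) T) (sorted_list_of_set B))"
    by (simp add: sorted_wrt_map)
  then have "sorted_wrt (<) (T # map ((+) T) (sorted_list_of_set B))"
    using assms by simp
  moreover have "sorted_wrt (<) (sorted_list_of_set (insert T ((+) T ` B)))"
    by simp
  ultimately show ?thesis
    using assms(1) by (intro strict_sorted_equal) (simp_all del: sorted_list_of_set_insert_remove)
qed

locale hardcore_network =
  fixes U V :: "'a set" and a :: "'a \<Rightarrow> real"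
  assumes finite_UV: "finite U" "finite V" and nonempty_UV: "U \<noteq> {}" "V \<noteq> {}"
    and disjoint_UV: "U \<inter> V = {}"
    and activation_nonneg: "\<And>i. i \<in> U \<union> V \<Longrightarrow> 0 \<le> a i"
begin

abbreviation "N \<equiv> U \<union> V"
abbreviation "q \<equiv> clock_rate a"

lemma finite_clocks: "finite (clocks N)"
  using finite_UV by (simp add: clocks_def)

lemma sum_clocks: "(\<Sum>k\<in>clocks N. f k) = (\<Sum>i\<in>N. f (Deactivation i)) + (\<Sum>i\<in>N. f (Activation i))"
  for f :: "'a clock \<Rightarrow> 'b :: comm_monoid_add"
  unfolding clocks_def using finite_UV
  by (subst sum.union_disjoint) (auto simp: sum.reindex inj_on_def)

sublocale clock_race "clocks N" "clock_rate a"
proof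
  show "finite (clocks N)" by (rule finite_clocks)
  show nn: "0 \<le> clock_rate a k" if "k \<in> clocks N" for k
    using that activation_nonneg by (auto simp: clocks_def)
  have "0 < card N" using finite_UV nonempty_UV by (simp add: card_gt_0_iff)
  then show "0 < sum (clock_rate a) (clocks N)"
    using activation_nonneg by (auto simp: sum_clocks intro!: add_pos_nonneg sum_nonneg)
qed

definition jump :: "'a clock \<Rightarrow> 'a set \<Rightarrow> 'a set" where
  "jump k x = (case k of Deactivation i \<Rightarrow> x - {i}
     | Activation i \<Rightarrow> if \<forall>j. neighbors U V i j \<longrightarrow> j \<notin> x then insert i x else x)"

lemma jump_subset: "k \<in> clocks N \<Longrightarrow> x \<subseteq> N \<Longrightarrow> jump k x \<subseteq> N"
  by (auto simp: jump_def clocks_def split: clock.splits)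

lemma winner_clock: "regular \<omega> \<Longrightarrow> winner \<omega> \<in> clocks N" and winner_rate: "regular \<omega> \<Longrightarrow> 0 < q (winner \<omega>)"
  using winner_in(1)[of \<omega>] by simp_all

lemma ticks_pos:
  assumes "regular \<omega>" "j \<in> clocks N" "t \<in> clock_ticks a \<omega> j" shows "0 < t"
proof -
  obtain n where "q j \<noteq> 0" and t: "t = (\<Sum>m\<le>n. \<omega> (j, m) / q j)"
    using assms(3) by (auto simp: clock_ticks_def split: if_splits)
  then have "0 < q j" using rate_nonneg[OF assms(2)] by simp
  then show ?thesis unfolding t
    using assms(1,2) by (intro sum_pos) (auto simp: regular_def)
qed

text \<open>
  Shortening the running gap by \<open>q j * gap \<omega>\<close> moves all ticks of clock \<open>j\<close> back by \<open>gap \<omega>\<close>; clock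
  \<open>winner \<omega>\<close> in addition loses its first tick, at \<open>gap \<omega>\<close>. A clock of rate \<open>0\<close> has no ticks on
  either side.
\<close>
lemma clock_ticks_step:
  assumes "regular \<omega>" "j \<in> clocks N"
  shows "clock_ticks a \<omega> j = (if j = winner \<omega> then {gap \<omega>} else {}) \<union> (+) (gap \<omega>) ` clock_ticks a (step \<omega>) j"
proof (cases "q j = 0")
  case True
  then show ?thesis using winner_rate[OF assms(1)] by (auto simp: clock_ticks_def)
next
  case False
  then have qj: "0 < q j" using rate_nonneg[OF assms(2)] by simp
  define k where "k = winner \<omega>"
  have k: "k \<in> clocks N" "0 < q k" using winner_clock[OF assms(1)] winner_rate[OF assms(1)] by (simp_all add: k_def)
  have gap: "gap \<omega> = \<omega> (k, 0) / q k" by (simp add: gap_def k_def)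
  show ?thesis
  proof (cases "j = k")
    case True
    have sums: "(\<Sum>m\<le>Suc n. \<omega> (k, m) / q k) = gap \<omega> + (\<Sum>m\<le>n. step \<omega> (k, m) / q k)" for n
      using k unfolding sum.atMost_Suc_shift gap step_def k_def[symmetric] by (simp add: restart_def)
    have "clock_ticks a \<omega> k = range (\<lambda>n. \<Sum>m\<le>n. \<omega> (k, m) / q k)"
      using k by (auto simp: clock_ticks_def)
    also have "\<dots> = insert (gap \<omega>) (range (\<lambda>n. \<Sum>m\<le>Suc n. \<omega> (k, m) / q k))"
    proof -
      have "UNIV = insert 0 (range Suc)" by (metis UNIV_nat_eq)
      then have "range (\<lambda>n. \<Sum>m\<le>n. \<omega> (k, m) / q k) = (\<lambda>n. \<Sum>m\<le>n. \<omega> (k, m) / q k) ` insert 0 (range Suc)"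
        by simp
      then show ?thesis by (simp add: image_image gap del: sum.atMost_Suc)
    qed
    also have "\<dots> = insert (gap \<omega>) ((+) (gap \<omega>) ` clock_ticks a (step \<omega>) k)"
      unfolding sums using k by (auto simp: clock_ticks_def)
    finally show ?thesis using True by (simp add: k_def)
  next
    case neq: False
    have sums: "(\<Sum>m\<le>n. \<omega> (j, m) / q j) = gap \<omega> + (\<Sum>m\<le>n. step \<omega> (j, m) / q j)" for n
    proof (induction n)
      case 0
      show ?case using neq qj k assms(2) unfolding gap step_def k_def[symmetric]
        by (simp add: restart_def field_simps)
    next
      case (Suc n)
      then show ?case using neq assms(2) by (simp add: step_def k_def[symmetric] restart_def)
    qed
    show ?thesis using neq qj sums unfolding k_def by (auto simp: clock_ticks_def)
  qed
qed

lemma all_ticks_step: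
  assumes "regular \<omega>"
  shows "all_ticks N a \<omega> = insert (gap \<omega>) ((+) (gap \<omega>) ` all_ticks N a (step \<omega>))"
proof -
  have "all_ticks N a \<omega>
      = (\<Union>j\<in>clocks N. (if j = winner \<omega> then {gap \<omega>} else {}) \<union> (+) (gap \<omega>) ` clock_ticks a (step \<omega>) j)"
    unfolding all_ticks_def by (intro SUP_cong refl clock_ticks_step assms)
  also have "\<dots> = (\<Union>j\<in>clocks N. if j = winner \<omega> then {gap \<omega>} else {}) \<union> (+) (gap \<omega>) ` all_ticks N a (step \<omega>)"
    unfolding all_ticks_def by (simp only: UN_Un_distrib image_UN)
  also have "(\<Union>j\<in>clocks N. if j = winner \<omega> then {gap \<omega>} else {}) = {gap \<omega>}"
    using winner_clock[OF assms] by (auto split: if_splits)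
  finally show ?thesis by simp
qed

lemma all_ticks_pos:
  assumes "regular \<omega>" "t \<in> all_ticks N a \<omega>" shows "0 < t"
proof -
  obtain j where "j \<in> clocks N" "t \<in> clock_ticks a \<omega> j" using assms(2) by (auto simp: all_ticks_def)
  then show ?thesis by (rule ticks_pos[OF assms(1)])
qed

lemma all_ticks_interval_step:
  assumes "regular \<omega>" "0 \<le> s" "regular (step \<omega>)"
  shows "all_ticks N a \<omega> \<inter> {0<..gap \<omega> + s}
       = insert (gap \<omega>) ((+) (gap \<omega>) ` (all_ticks N a (step \<omega>) \<inter> {0<..s}))"
proof -
  have "0 < t" "0 < gap \<omega> + t" if "t \<in> all_ticks N a (step \<omega>)" for t
    using all_ticks_pos[OF assms(3) that] gap_pos[OF assms(1)] by simp_all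
  then show ?thesis
    using gap_pos[OF assms(1)] assms(2) by (auto simp: all_ticks_step[OF assms(1)])
qed

text \<open>
  Each step contributes exactly one tick, so only finitely many precede the \<open>n\<close>-th one.
\<close>
lemma finite_ticks_race_time:
  "good \<omega> \<Longrightarrow> 0 \<le> race_time n \<omega> \<and> finite (all_ticks N a \<omega> \<inter> {0<..race_time n \<omega>})"
proof (induction n arbitrary: \<omega>)
  case (Suc n)
  note g = Suc(2) good_step[OF Suc(2)]
  show ?case
    using Suc(1)[OF g(2)] gap_pos[OF good_regular[OF g(1)]]
    by (simp add: all_ticks_interval_step good_regular g)
qed simp

text \<open>
  \<open>process\<close> sorts the set of all past ticks, which is meaningful because this set is finite.
\<close>
lemma finite_ticks: 
  assumes "good \<omega>" shows "finite (all_ticks N a \<omega> \<inter> {0<..t})"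
proof -
  obtain n where "t < race_time n \<omega>" using assms by (auto simp: good_def)
  then show ?thesis
    using finite_ticks_race_time[OF assms, of n] by (elim conjE finite_subset[rotated]) auto
qed

lemma update_first:
  assumes "good \<omega>" "x \<subseteq> N"
  shows "update U V a \<omega> (gap \<omega>) x = jump (winner \<omega>) x"
proof -
  have r: "regular \<omega>" "regular (step \<omega>)" using assms good_regular good_step by blast+
  have tick: "gap \<omega> \<in> clock_ticks a \<omega> j \<longleftrightarrow> j = winner \<omega>" if "j \<in> clocks N" for j
  proof -
    have "0 \<notin> clock_ticks a (step \<omega>) j" using ticks_pos[OF r(2) that, of 0] by auto
    then show ?thesis using clock_ticks_step[OF r(1) that] by auto
  qed
  have cl: "Deactivation i \<in> clocks N" "Activation i \<in> clocks N" if "i \<in> N" for i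
    using that by (auto simp: clocks_def)
  show ?thesis
  proof (rule set_eqI)
    fix i
    have "i \<in> update U V a \<omega> (gap \<omega>) x \<longleftrightarrow> i \<in> N \<and>
       (if i \<in> x then Deactivation i \<noteq> winner \<omega>
        else Activation i = winner \<omega> \<and> (\<forall>j. neighbors U V i j \<longrightarrow> j \<notin> x))"
      unfolding update_def mem_Collect_eq using tick[OF cl(1)[of i]] tick[OF cl(2)[of i]] by argo
    also have "\<dots> \<longleftrightarrow> i \<in> jump (winner \<omega>) x"
      using assms(2) winner_clock[OF r(1)]
      by (cases "winner \<omega>") (auto simp: jump_def clocks_def)
    finally show "i \<in> update U V a \<omega> (gap \<omega>) x \<longleftrightarrow> i \<in> jump (winner \<omega>) x" .
  qed
qed

lemma update_later:
  assumes "good \<omega>" "0 < s"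
  shows "update U V a \<omega> (gap \<omega> + s) x = update U V a (step \<omega>) s x"
proof -
  have tick: "gap \<omega> + s \<in> clock_ticks a \<omega> j \<longleftrightarrow> s \<in> clock_ticks a (step \<omega>) j" if "j \<in> clocks N" for j
    using clock_ticks_step[OF good_regular[OF assms(1)] that] assms(2) by auto
  have cl: "Deactivation i \<in> clocks N" "Activation i \<in> clocks N" if "i \<in> N" for i
    using that by (auto simp: clocks_def)
  show ?thesis
    unfolding update_def
  proof (rule Collect_cong)
    fix i
    show "(i \<in> N \<and> (if i \<in> x then gap \<omega> + s \<notin> clock_ticks a \<omega> (Deactivation i)
        else gap \<omega> + s \<in> clock_ticks a \<omega> (Activation i) \<and> (\<forall>j. neighbors U V i j \<longrightarrow> j \<notin> x)))
     \<longleftrightarrow> (i \<in> N \<and> (if i \<in> x then s \<notin> clock_ticks a (step \<omega>) (Deactivation i)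
        else s \<in> clock_ticks a (step \<omega>) (Activation i) \<and> (\<forall>j. neighbors U V i j \<longrightarrow> j \<notin> x)))"
      using tick[OF cl(1)[of i]] tick[OF cl(2)[of i]] by argo
  qed
qed

lemma process_before_first:
  assumes "good \<omega>" "t < gap \<omega>" shows "process U V a x \<omega> t = x"
proof -
  have r: "regular \<omega>" "regular (step \<omega>)" using assms good_regular good_step by blast+
  have "all_ticks N a \<omega> \<inter> {0<..t} = {}"
    using assms(2) all_ticks_pos[OF r(2)] by (force simp: all_ticks_step[OF r(1)])
  then show ?thesis by (simp add: process_def)
qed

lemma process_step:
  assumes "good \<omega>" "0 \<le> s" "x \<subseteq> N"
  shows "process U V a x \<omega> (gap \<omega> + s) = process U V a (jump (winner \<omega>) x) (step \<omega>) s"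
proof -
  have r: "regular \<omega>" "regular (step \<omega>)" using assms good_regular good_step by blast+
  let ?B = "all_ticks N a (step \<omega>) \<inter> {0<..s}"
  have fin: "finite ?B" by (rule finite_ticks[OF good_step[OF assms(1)]])
  have "fold (update U V a \<omega> \<circ> (+) (gap \<omega>)) (sorted_list_of_set ?B) y
      = fold (update U V a (step \<omega>)) (sorted_list_of_set ?B) y" for y
    using fin update_later[OF assms(1)] by (intro fold_cong) (auto simp: fun_eq_iff)
  then show ?thesis
    unfolding process_def all_ticks_interval_step[OF r(1) assms(2) r(2)]
    by (subst sorted_list_of_set_insert_shift[OF fin])
       (auto simp: fold_map update_first assms)
qed

lemma hitting_time_same: "hitting_time U V a x x \<omega> = 0"
proof -
  have "process U V a x \<omega> 0 = x" by (simp add: process_def)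
  then have "hitting_time U V a x x \<omega> \<le> ennreal 0"
    unfolding hitting_time_def by (intro INF_lower) auto
  then show ?thesis by simp
qed

text \<open>
  A path that starts outside the target cannot meet it before the first tick; afterwards it is the
  path of the restarted clocks, delayed by \<open>gap \<omega>\<close>.
\<close>
lemma hitting_time_step:
  assumes "good \<omega>" "x \<subseteq> N" "x \<noteq> y"
  shows "hitting_time U V a x y \<omega>
       = ennreal (gap \<omega>) + hitting_time U V a (jump (winner \<omega>) x) y (step \<omega>)"
proof (rule antisym)
  have g0: "0 < gap \<omega>" by (rule gap_pos[OF good_regular[OF assms(1)]])
  let ?S = "{s. 0 \<le> s \<and> process U V a (jump (winner \<omega>) x) (step \<omega>) s = y}"
  \<comment> \<open>Subtracting on the left covers the case that the target is never hit and the infimum is over the empty set.\<close>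
  have "hitting_time U V a x y \<omega> - ennreal (gap \<omega>) \<le> hitting_time U V a (jump (winner \<omega>) x) y (step \<omega>)"
    unfolding hitting_time_def[of U V a "jump (winner \<omega>) x"]
  proof (rule INF_greatest)
    fix s assume s: "s \<in> ?S"
    then have "hitting_time U V a x y \<omega> \<le> ennreal (gap \<omega> + s)"
      unfolding hitting_time_def using g0 process_step[OF assms(1) _ assms(2), of s]
      by (intro INF_lower) simp
    then show "hitting_time U V a x y \<omega> - ennreal (gap \<omega>) \<le> ennreal s"
      using s g0 by (simp add: ennreal_minus_le_iff)
  qed
  then show "hitting_time U V a x y \<omega>
       \<le> ennreal (gap \<omega>) + hitting_time U V a (jump (winner \<omega>) x) y (step \<omega>)"
    by (simp add: ennreal_minus_le_iff)
  show "ennreal (gap \<omega>) + hitting_time U V a (jump (winner \<omega>) x) y (step \<omega>)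
      \<le> hitting_time U V a x y \<omega>"
    unfolding hitting_time_def[of U V a x]
  proof (rule INF_greatest)
    fix t assume t: "t \<in> {t. 0 \<le> t \<and> process U V a x \<omega> t = y}"
    then have "gap \<omega> \<le> t" using process_before_first[OF assms(1), of t x] assms(3) by force
    then have s: "0 \<le> t - gap \<omega>" by simp
    have "process U V a (jump (winner \<omega>) x) (step \<omega>) (t - gap \<omega>) = y"
      using process_step[OF assms(1) s assms(2)] t by simp
    then have "hitting_time U V a (jump (winner \<omega>) x) y (step \<omega>) \<le> ennreal (t - gap \<omega>)"
      unfolding hitting_time_def using s by (intro INF_lower) auto
    then have "ennreal (gap \<omega>) + hitting_time U V a (jump (winner \<omega>) x) y (step \<omega>)
       \<le> ennreal (gap \<omega>) + ennreal (t - gap \<omega>)" by (rule add_left_mono)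
    also have "\<dots> = ennreal t" using g0 s by (simp flip: ennreal_plus)
    finally show "ennreal (gap \<omega>) + hitting_time U V a (jump (winner \<omega>) x) y (step \<omega>) \<le> ennreal t" .
  qed
qed

section \<open>The first-step equation\<close>
text \<open>
  The time until \<open>y\<close> is hit or \<open>n\<close> ticks have occurred, whichever comes first. Since the recursion
  follows the winning clock, measurability and the mean are obtained clock by clock, without
  touching the uncountable infimum in \<open>hitting_time\<close>.
\<close>
fun capped_time :: "nat \<Rightarrow> 'a set \<Rightarrow> 'a set \<Rightarrow> ('a clock \<times> nat \<Rightarrow> real) \<Rightarrow> ennreal" where
  "capped_time 0 y x \<omega> = 0"
| "capped_time (Suc n) y x \<omega> = (if x = y then 0 else
     (\<Sum>k\<in>Kp. if wins (clocks N) q k \<omega>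
        then ennreal (\<omega> (k, 0) / q k) + capped_time n y (jump k x) (restart (clocks N) q k \<omega>) else 0))"

lemma capped_time_step:
  assumes "regular \<omega>" "x \<noteq> y"
  shows "capped_time (Suc n) y x \<omega> = ennreal (gap \<omega>) + capped_time n y (jump (winner \<omega>) x) (step \<omega>)"
  using assms by (simp add: winner_sum gap_def step_def)

lemma capped_time_le:
  "good \<omega> \<Longrightarrow> x \<subseteq> N \<Longrightarrow> capped_time n y x \<omega> \<le> hitting_time U V a x y \<omega>"
proof (induction n arbitrary: x \<omega>)
  case (Suc n)
  show ?case
  proof (cases "x = y")
    case False
    have "jump (winner \<omega>) x \<subseteq> N"
      using jump_subset winner_clock good_regular Suc.prems by blast
    with Suc.IH[OF good_step[OF Suc.prems(1)] this] False show ?thesis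
      unfolding capped_time_step[OF good_regular[OF Suc.prems(1)] False]
        hitting_time_step[OF Suc.prems False] by (intro add_left_mono)
  qed simp
qed simp

lemma capped_time_dichotomy:
  "good \<omega> \<Longrightarrow> x \<subseteq> N \<Longrightarrow> capped_time n y x \<omega> = hitting_time U V a x y \<omega>
     \<or> capped_time n y x \<omega> = ennreal (race_time n \<omega>)"
proof (induction n arbitrary: x \<omega>)
  case (Suc n)
  show ?case
  proof (cases "x = y")
    case True
    then show ?thesis by (simp add: hitting_time_same)
  next
    case False
    note g = Suc.prems(1) good_step[OF Suc.prems(1)]
    have "jump (winner \<omega>) x \<subseteq> N"
      using jump_subset winner_clock good_regular Suc.prems by blast
    from Suc.IH[OF g(2) this] show ?thesis
      unfolding capped_time_step[OF good_regular[OF Suc.prems(1)] False]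
        hitting_time_step[OF Suc.prems False]
      using finite_ticks_race_time[OF g(2), of n] gap_pos[OF good_regular[OF g(1)]]
      by auto
  qed
qed simp

text \<open>
  Either the truncation is not felt from some \<open>n\<close> on, or it is always felt, and then the truncated
  times are the tick times, which are unbounded.
\<close>
lemma hitting_time_eq_SUP:
  assumes "good \<omega>" "x \<subseteq> N"
  shows "hitting_time U V a x y \<omega> = (SUP n. capped_time n y x \<omega>)"
proof (rule antisym)
  show "(SUP n. capped_time n y x \<omega>) \<le> hitting_time U V a x y \<omega>"
    by (intro SUP_least capped_time_le assms)
  show "hitting_time U V a x y \<omega> \<le> (SUP n. capped_time n y x \<omega>)"
  proof (cases "\<exists>n. capped_time n y x \<omega> = hitting_time U V a x y \<omega>")
    case True
    then show ?thesis by (metis SUP_upper UNIV_I)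
  next
    case False
    then have eq: "capped_time n y x \<omega> = ennreal (race_time n \<omega>)" for n
      using capped_time_dichotomy[OF assms] by blast
    have "of_nat m \<le> (SUP n. capped_time n y x \<omega>)" for m
    proof -
      obtain n where "real m < race_time n \<omega>" using assms(1) by (auto simp: good_def)
      then have "of_nat m \<le> capped_time n y x \<omega>"
        unfolding eq by (simp add: ennreal_leI flip: ennreal_of_nat_eq_real_of_nat)
      also have "\<dots> \<le> (SUP n. capped_time n y x \<omega>)" by (rule SUP_upper) simp
      finally show ?thesis .
    qed
    then have "(SUP n. capped_time n y x \<omega>) = \<top>"
      using ennreal_Ex_less_of_nat[of "SUP n. capped_time n y x \<omega>"] by (meson leD less_top)
    then show ?thesis by (simp only: top_greatest)
  qed
qed

lemma capped_time_measurable[measurable]: "capped_time n y x \<in> borel_measurable \<Omega>"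
proof (induction n arbitrary: x)
  case 0
  then show ?case by (simp cong: measurable_cong)
next
  case (Suc n)
  have [measurable]: "capped_time n y x \<in> borel_measurable \<Omega>" for x by fact
  have "(\<lambda>\<omega>. \<Sum>k\<in>Kp. if wins (clocks N) q k \<omega>
        then ennreal (\<omega> (k, 0) / q k) + capped_time n y (jump k x) (restart (clocks N) q k \<omega>) else 0)
      \<in> borel_measurable \<Omega>"
  proof (intro borel_measurable_sum)
    fix k assume "k \<in> Kp"
    then have [measurable]: "k \<in> clocks N" by simp
    show "(\<lambda>\<omega>. if wins (clocks N) q k \<omega>
        then ennreal (\<omega> (k, 0) / q k) + capped_time n y (jump k x) (restart (clocks N) q k \<omega>) else 0)
      \<in> borel_measurable \<Omega>" by measurable
  qed
  then show ?case by simp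
qed

lemma capped_time_mono: "capped_time n y x \<omega> \<le> capped_time (Suc n) y x \<omega>"
proof (induction n arbitrary: x \<omega>)
  case (Suc n)
  show ?case
  proof (cases "x = y")
    case False
    show ?thesis
      unfolding capped_time.simps(2)[of "Suc n" y x \<omega>] capped_time.simps(2)[of n y x \<omega>] if_not_P[OF False]
    proof (rule sum_mono)
      fix k
      show "(if wins (clocks N) q k \<omega>
          then ennreal (\<omega> (k, 0) / q k) + capped_time n y (jump k x) (restart (clocks N) q k \<omega>) else 0)
        \<le> (if wins (clocks N) q k \<omega>
          then ennreal (\<omega> (k, 0) / q k) + capped_time (Suc n) y (jump k x) (restart (clocks N) q k \<omega>) else 0)"
        using Suc[of "jump k x" "restart (clocks N) q k \<omega>"]
        by (simp add: add_left_mono del: capped_time.simps)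
    qed
  qed simp
qed simp

lemma nn_integral_capped_time_Suc:
  assumes "x \<noteq> y"
  shows "(\<integral>\<^sup>+\<omega>. capped_time (Suc n) y x \<omega> \<partial>\<Omega>)
     = ennreal (1 / R) + (\<Sum>k\<in>clocks N. ennreal (q k / R) * (\<integral>\<^sup>+\<omega>. capped_time n y (jump k x) \<omega> \<partial>\<Omega>))"
proof -
  interpret prob_space \<Omega> by (rule prob_space_exp_seqs)
  let ?C = "\<lambda>k. \<integral>\<^sup>+\<omega>. capped_time n y (jump k x) \<omega> \<partial>\<Omega>"
  have "(\<integral>\<^sup>+\<omega>. capped_time (Suc n) y x \<omega> \<partial>\<Omega>) = (\<Sum>k\<in>Kp. \<integral>\<^sup>+\<omega>. (if wins (clocks N) q k \<omega>
        then ennreal (\<omega> (k, 0) / q k) + capped_time n y (jump k x) (restart (clocks N) q k \<omega>) else 0) \<partial>\<Omega>)"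
    using assms unfolding capped_time.simps if_not_P[OF assms]
  proof (intro nn_integral_sum)
    fix k assume "k \<in> Kp"
    then have [measurable]: "k \<in> clocks N" by simp
    show "(\<lambda>\<omega>. if wins (clocks N) q k \<omega>
        then ennreal (\<omega> (k, 0) / q k) + capped_time n y (jump k x) (restart (clocks N) q k \<omega>) else 0)
      \<in> borel_measurable \<Omega>" by measurable
  qed
  also have "\<dots> = (\<Sum>k\<in>Kp. ennreal (q k / R\<^sup>2) + ennreal (q k / R) * ?C k)"
  proof (intro sum.cong refl)
    fix k assume k: "k \<in> Kp"
    then have [measurable]: "k \<in> clocks N" by simp
    have "(\<integral>\<^sup>+\<omega>. (if wins (clocks N) q k \<omega>
        then ennreal (\<omega> (k, 0) / q k) + capped_time n y (jump k x) (restart (clocks N) q k \<omega>) else 0) \<partial>\<Omega>)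
      = (\<integral>\<^sup>+\<omega>. (if wins (clocks N) q k \<omega>
          then ennreal ((\<omega> (k, 0) / q k) ^ 1 * exp (- (0 * (\<omega> (k, 0) / q k)))) * (\<lambda>_. 1) (restart (clocks N) q k \<omega>) else 0)
        + (if wins (clocks N) q k \<omega>
          then ennreal ((\<omega> (k, 0) / q k) ^ 0 * exp (- (0 * (\<omega> (k, 0) / q k)))) * capped_time n y (jump k x) (restart (clocks N) q k \<omega>) else 0) \<partial>\<Omega>)"
      by (intro nn_integral_cong) simp
    also have "\<dots> = (\<integral>\<^sup>+\<omega>. (if wins (clocks N) q k \<omega>
          then ennreal ((\<omega> (k, 0) / q k) ^ 1 * exp (- (0 * (\<omega> (k, 0) / q k)))) * (\<lambda>_. 1) (restart (clocks N) q k \<omega>) else 0) \<partial>\<Omega>)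
        + (\<integral>\<^sup>+\<omega>. (if wins (clocks N) q k \<omega>
          then ennreal ((\<omega> (k, 0) / q k) ^ 0 * exp (- (0 * (\<omega> (k, 0) / q k)))) * capped_time n y (jump k x) (restart (clocks N) q k \<omega>) else 0) \<partial>\<Omega>)"
      by (intro nn_integral_add) measurable
    also have "\<dots> = ennreal (q k / R\<^sup>2) + ennreal (q k / R) * ?C k"
      using k by (subst (1 2) nn_integral_race_power_exp) (simp_all add: emeasure_space_1 power2_eq_square)
    finally show "(\<integral>\<^sup>+\<omega>. (if wins (clocks N) q k \<omega>
        then ennreal (\<omega> (k, 0) / q k) + capped_time n y (jump k x) (restart (clocks N) q k \<omega>) else 0) \<partial>\<Omega>)
        = ennreal (q k / R\<^sup>2) + ennreal (q k / R) * ?C k" .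
  qed
  also have "\<dots> = (\<Sum>k\<in>Kp. ennreal (q k / R\<^sup>2)) + (\<Sum>k\<in>Kp. ennreal (q k / R) * ?C k)"
    by (rule sum.distrib)
  also have "(\<Sum>k\<in>Kp. ennreal (q k / R\<^sup>2)) = ennreal (\<Sum>k\<in>Kp. q k / R\<^sup>2)"
    by (intro sum_ennreal) auto
  also have "(\<Sum>k\<in>Kp. q k / R\<^sup>2) = 1 / R"
    using total_pos sum_Kp by (simp add: sum_divide_distrib[symmetric] power2_eq_square)
  also have "(\<Sum>k\<in>Kp. ennreal (q k / R) * ?C k) = (\<Sum>k\<in>clocks N. ennreal (q k / R) * ?C k)"
  proof (rule sum.mono_neutral_left)
    show "\<forall>k\<in>clocks N - Kp. ennreal (q k / R) * ?C k = 0"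
    proof
      fix k assume "k \<in> clocks N - Kp"
      then have "q k = 0" using rate_nonneg[of k] by simp
      then show "ennreal (q k / R) * ?C k = 0" by simp
    qed
  qed (use finite_K in auto)
  finally show ?thesis .
qed

end

section \<open>The chain of activity levels\<close>
text \<open>
  Level \<open>j \<le> n\<close> stands for \<open>n - j\<close> active nodes of \<open>U\<close>, level \<open>n + l\<close> for \<open>l\<close> active nodes of \<open>V\<close>; the
  empty configuration is level \<open>n\<close>. Moving up means deactivation in \<open>U\<close> below level \<open>n\<close>, and
  activation in \<open>V\<close>, at rate \<open>b\<close> per inactive node, from there on.
\<close>
definition up_rate :: "nat \<Rightarrow> nat \<Rightarrow> real \<Rightarrow> nat \<Rightarrow> real" where
  "up_rate n m b j = (if j < n then real (n - j) else real (n + m - j) * b)"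

definition down_rate :: "nat \<Rightarrow> real \<Rightarrow> nat \<Rightarrow> real" where
  "down_rate n a j = (if j \<le> n then real j * a else real (j - n))"

text \<open>
  The mean time \<open>e\<^sub>j\<close> from level \<open>j\<close> to \<open>j + 1\<close>. Waiting for the first move and returning from
  \<open>j - 1\<close> if that move leads down gives \<open>\<lambda>\<^sub>j e\<^sub>j = 1 + \<mu>\<^sub>j e\<^bsub>j-1\<^esub>\<close>.
\<close>
fun passage_time :: "nat \<Rightarrow> nat \<Rightarrow> real \<Rightarrow> real \<Rightarrow> nat \<Rightarrow> real" where
  "passage_time n m a b 0 = 1 / up_rate n m b 0"
| "passage_time n m a b (Suc j)
     = (1 + down_rate n a (Suc j) * passage_time n m a b j) / up_rate n m b (Suc j)"

definition crossing_time :: "nat \<Rightarrow> nat \<Rightarrow> real \<Rightarrow> real \<Rightarrow> real" where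
  "crossing_time n m a b = (\<Sum>j<n + m. passage_time n m a b j)"

lemma up_rate_pos: "0 < b \<Longrightarrow> j < n + m \<Longrightarrow> 0 < up_rate n m b j"
  by (auto simp: up_rate_def)

lemma up_rate_nonneg: "0 \<le> b \<Longrightarrow> 0 \<le> up_rate n m b j"
  by (auto simp: up_rate_def)

lemma down_rate_nonneg: "0 \<le> a \<Longrightarrow> 0 \<le> down_rate n a j"
  by (auto simp: down_rate_def)

lemma passage_time_nonneg: "0 \<le> a \<Longrightarrow> 0 \<le> b \<Longrightarrow> 0 \<le> passage_time n m a b j"
  by (induction j) (auto intro!: divide_nonneg_nonneg add_nonneg_nonneg mult_nonneg_nonneg
      up_rate_nonneg down_rate_nonneg)

locale two_rate_network =
  fixes U V :: "'a set" and rU rV :: real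
  assumes fin: "finite U" "finite V" and ne: "U \<noteq> {}" "V \<noteq> {}" and disj: "U \<inter> V = {}"
    and rates: "0 \<le> rU" "0 \<le> rV"
begin

abbreviation "rate \<equiv> (\<lambda>i. if i \<in> U then rU else rV)"

sublocale hardcore_network U V rate
  by unfold_locales (use fin ne disj rates in auto)

abbreviation "n \<equiv> card U"
abbreviation "m \<equiv> card V"

lemma card_pos: "0 < n" "0 < m"
  using fin ne by (auto simp: card_gt_0_iff)

definition admissible :: "'a set \<Rightarrow> bool" where
  "admissible x \<longleftrightarrow> x \<subseteq> U \<or> x \<subseteq> V"

definition level :: "'a set \<Rightarrow> nat" where
  "level x = (if x \<subseteq> U then n - card x else n + card x)"

lemma level_U: "x \<subseteq> U \<Longrightarrow> level x = n - card x"
  by (simp add: level_def)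

lemma level_V: "x \<subseteq> V \<Longrightarrow> level x = n + card x"
  using disj by (cases "x = {}") (auto simp: level_def)

lemma jump_Deactivation: "jump (Deactivation i) x = x - {i}"
  by (simp add: jump_def)

lemma jump_Activation_U:
  "i \<in> U \<Longrightarrow> jump (Activation i) x = (if x \<inter> V = {} then insert i x else x)"
  using disj by (auto simp: jump_def neighbors_def)

lemma jump_Activation_V:
  "i \<in> V \<Longrightarrow> jump (Activation i) x = (if x \<inter> U = {} then insert i x else x)"
  using disj by (auto simp: jump_def neighbors_def)

lemma admissible_jump:
  assumes "admissible x" "k \<in> clocks N" shows "admissible (jump k x)"
proof -
  consider i where "k = Deactivation i" | i where "k = Activation i" "i \<in> U" | i where "k = Activation i" "i \<in> V"
    using assms(2) by (auto simp: clocks_def)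
  then show ?thesis
  proof cases
    case 1
    then show ?thesis using assms(1) by (auto simp: jump_Deactivation admissible_def)
  next
    case 2
    then show ?thesis using assms(1) disj by (auto simp: jump_Activation_U admissible_def)
  next
    case 3
    then show ?thesis using assms(1) disj by (auto simp: jump_Activation_V admissible_def)
  qed
qed

lemma level_top_iff: assumes "admissible x" shows "level x = n + m \<longleftrightarrow> x = V"
proof (cases "x \<subseteq> U")
  case True
  have "x \<noteq> V" using True disj ne by blast
  moreover have "level x \<noteq> n + m" using level_U[OF True] card_pos by linarith
  ultimately show ?thesis by simp
next
  case False
  then have x: "x \<subseteq> V" using assms by (simp add: admissible_def)
  show ?thesis using level_V[OF x] card_subset_eq[OF fin(2) x] by auto
qed

lemma level_le: assumes "admissible x" shows "level x \<le> n + m"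
proof (cases "x \<subseteq> U")
  case True
  then show ?thesis by (simp add: level_U)
next
  case False
  then have x: "x \<subseteq> V" using assms by (simp add: admissible_def)
  then show ?thesis using card_mono[OF fin(2) x] by (simp add: level_V)
qed

lemma level_attained: assumes "j \<le> n + m" shows "\<exists>x. admissible x \<and> level x = j"
proof (cases "j \<le> n")
  case True
  then have "n - j \<le> n" by simp
  then obtain x where "x \<subseteq> U" "card x = n - j" by (rule obtain_subset_with_card_n)
  then show ?thesis using True by (intro exI[of _ x]) (auto simp: level_U admissible_def)
next
  case False
  then have "j - n \<le> m" using assms by simp
  then obtain x where "x \<subseteq> V" "card x = j - n" by (rule obtain_subset_with_card_n)
  then show ?thesis using False by (intro exI[of _ x]) (auto simp: level_V admissible_def)
qed

lemma sum_subset_const: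
  "finite A \<Longrightarrow> x \<subseteq> A \<Longrightarrow> (\<Sum>i\<in>A. if i \<in> x then c else 0) = real (card x) * (c :: real)"
  "finite A \<Longrightarrow> x \<subseteq> A \<Longrightarrow> (\<Sum>i\<in>A. if i \<in> x then 0 else c) = real (card A - card x) * (c :: real)"
proof -
  assume A: "finite A" "x \<subseteq> A"
  have "A \<inter> {i. i \<in> x} = x" "A \<inter> - {i. i \<in> x} = A - x" using A by auto
  with A show "(\<Sum>i\<in>A. if i \<in> x then c else 0) = real (card x) * c"
    "(\<Sum>i\<in>A. if i \<in> x then 0 else c) = real (card A - card x) * c"
    by (simp_all add: sum.If_cases card_Diff_subset finite_subset)
qed

text \<open>
  By symmetry, the change of a function of the level depends only on how many nodes can move it up
  or down; all other ticks are without effect.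
\<close>
lemma generator_level:
  fixes \<psi> :: "nat \<Rightarrow> real"
  assumes "admissible x"
  shows "(\<Sum>k\<in>clocks N. clock_rate rate k * (\<psi> (level (jump k x)) - \<psi> (level x)))
       = up_rate n m rV (level x) * (\<psi> (Suc (level x)) - \<psi> (level x))
       + down_rate n rU (level x) * (\<psi> (level x - 1) - \<psi> (level x))"
proof -
  let ?D = "\<lambda>k. \<psi> (level (jump k x)) - \<psi> (level x)"
  have split: "(\<Sum>k\<in>clocks N. clock_rate rate k * ?D k)
     = (\<Sum>i\<in>U. ?D (Deactivation i)) + (\<Sum>i\<in>V. ?D (Deactivation i))
       + ((\<Sum>i\<in>U. rU * ?D (Activation i)) + (\<Sum>i\<in>V. rV * ?D (Activation i)))"
  proof -
    have "(\<Sum>i\<in>V. clock_rate rate (Activation i) * ?D (Activation i)) = (\<Sum>i\<in>V. rV * ?D (Activation i))"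
      using disj by (intro sum.cong) auto
    then show ?thesis
      unfolding sum_clocks using fin disj by (simp add: sum.union_disjoint)
  qed
  show ?thesis
  proof (cases "x \<subseteq> U")
    case True
    have xV: "x \<inter> V = {}" using True disj by blast
    have cx: "card x \<le> n" "finite x" using True fin by (auto intro: card_mono finite_subset)
    have 1: "(\<Sum>i\<in>U. ?D (Deactivation i)) = real (card x) * (\<psi> (Suc (n - card x)) - \<psi> (n - card x))"
      unfolding sum_subset_const(1)[OF fin(1) True, symmetric]
    proof (intro sum.cong refl)
      fix i assume "i \<in> U"
      show "?D (Deactivation i) = (if i \<in> x then \<psi> (Suc (n - card x)) - \<psi> (n - card x) else 0)"
      proof (cases "i \<in> x")
        case i: True
        then have "0 < card x" using cx by (auto simp: card_gt_0_iff)
        then have "level (x - {i}) = Suc (n - card x)"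
          using i cx True by (subst level_U) auto
        then show ?thesis using i True by (simp add: jump_Deactivation level_U)
      qed (simp add: jump_Deactivation)
    qed
    have 2: "(\<Sum>i\<in>V. ?D (Deactivation i)) = 0"
    proof (intro sum.neutral ballI)
      fix i assume "i \<in> V"
      then have "x - {i} = x" using xV by blast
      then show "?D (Deactivation i) = 0" by (simp add: jump_Deactivation)
    qed
    have 3: "(\<Sum>i\<in>U. rU * ?D (Activation i)) = real (n - card x) * (rU * (\<psi> (n - card x - 1) - \<psi> (n - card x)))"
      unfolding sum_subset_const(2)[OF fin(1) True, symmetric]
    proof (intro sum.cong refl)
      fix i assume i: "i \<in> U"
      have "level (insert i x) = n - card x - 1" if "i \<notin> x"
        using that i True cx by (subst level_U) auto
      then show "rU * ?D (Activation i) = (if i \<in> x then 0 else rU * (\<psi> (n - card x - 1) - \<psi> (n - card x)))"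
        using True by (simp add: jump_Activation_U[OF i] xV level_U insert_absorb)
    qed
    have 4: "(\<Sum>i\<in>V. rV * ?D (Activation i)) = (if x = {} then real m * rV * (\<psi> (Suc n) - \<psi> n) else 0)"
    proof (cases "x = {}")
      case True
      then show ?thesis by (simp add: jump_Activation_V level_V)
    next
      case False
      then have "x \<inter> U \<noteq> {}" using True by blast
      then show ?thesis using False by (simp add: jump_Activation_V)
    qed
    show ?thesis
    proof (cases "x = {}")
      case True
      then show ?thesis unfolding split 1 2 3 4 by (simp add: level_U up_rate_def down_rate_def)
    next
      case False
      then have "0 < card x" using cx by (simp add: card_gt_0_iff)
      then show ?thesis unfolding split 1 2 3 4 using False True cx card_pos
        by (simp add: level_U up_rate_def down_rate_def)
    qed
  next
    case False
    then have x: "x \<subseteq> V" "x \<noteq> {}" using assms by (auto simp: admissible_def)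
    have xU: "x \<inter> U = {}" and xV: "x \<inter> V \<noteq> {}" using x disj by blast+
    have cx: "card x \<le> m" "finite x" using x fin by (auto intro: card_mono finite_subset)
    then have c0: "0 < card x" using x by (simp add: card_gt_0_iff)
    have 1: "(\<Sum>i\<in>V. ?D (Deactivation i)) = real (card x) * (\<psi> (n + card x - 1) - \<psi> (n + card x))"
      unfolding sum_subset_const(1)[OF fin(2) x(1), symmetric]
    proof (intro sum.cong refl)
      fix i assume "i \<in> V"
      show "?D (Deactivation i) = (if i \<in> x then \<psi> (n + card x - 1) - \<psi> (n + card x) else 0)"
      proof (cases "i \<in> x")
        case i: True
        have "x - {i} \<subseteq> V" using x by blast
        then have "level (x - {i}) = n + card x - 1"
          using i cx c0 by (simp add: level_V)
        then show ?thesis using i x by (simp add: jump_Deactivation level_V)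
      qed (simp add: jump_Deactivation)
    qed
    have 2: "(\<Sum>i\<in>U. ?D (Deactivation i)) = 0"
    proof (intro sum.neutral ballI)
      fix i assume "i \<in> U"
      then have "x - {i} = x" using xU by blast
      then show "?D (Deactivation i) = 0" by (simp add: jump_Deactivation)
    qed
    have 3: "(\<Sum>i\<in>V. rV * ?D (Activation i)) = real (m - card x) * (rV * (\<psi> (Suc (n + card x)) - \<psi> (n + card x)))"
      unfolding sum_subset_const(2)[OF fin(2) x(1), symmetric]
    proof (intro sum.cong refl)
      fix i assume i: "i \<in> V"
      have "level (insert i x) = Suc (n + card x)" if "i \<notin> x"
        using that i x cx by (subst level_V) auto
      then show "rV * ?D (Activation i) = (if i \<in> x then 0 else rV * (\<psi> (Suc (n + card x)) - \<psi> (n + card x)))"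
        using x by (simp add: jump_Activation_V[OF i] xU level_V insert_absorb)
    qed
    have 4: "(\<Sum>i\<in>U. rU * ?D (Activation i)) = 0"
      using xV by (simp add: jump_Activation_U)
    show ?thesis unfolding split 1 2 3 4 using x c0
      by (simp add: level_V up_rate_def down_rate_def)
  qed
qed

lemma jump_average_level:
  fixes \<psi> :: "nat \<Rightarrow> real"
  assumes "admissible x"
  shows "1 / R + (\<Sum>k\<in>clocks N. clock_rate rate k / R * \<psi> (level (jump k x)))
       = \<psi> (level x) + (1 + up_rate n m rV (level x) * (\<psi> (Suc (level x)) - \<psi> (level x))
       + down_rate n rU (level x) * (\<psi> (level x - 1) - \<psi> (level x))) / R"
proof -
  have "(\<Sum>k\<in>clocks N. clock_rate rate k * (\<psi> (level (jump k x)) - \<psi> (level x)))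
     = (\<Sum>k\<in>clocks N. clock_rate rate k * \<psi> (level (jump k x))) - R * \<psi> (level x)"
    by (simp add: right_diff_distrib sum_subtractf sum_distrib_right)
  moreover have "(\<Sum>k\<in>clocks N. clock_rate rate k / R * \<psi> (level (jump k x)))
     = (\<Sum>k\<in>clocks N. clock_rate rate k * \<psi> (level (jump k x))) / R"
    by (simp add: sum_divide_distrib)
  ultimately show ?thesis
    using generator_level[OF assms, of \<psi>] total_pos by (simp add: field_simps)
qed

text \<open>
  The means of the truncated hitting times of \<open>V\<close>, as a function of the level alone.
\<close>
fun chain_time :: "nat \<Rightarrow> nat \<Rightarrow> real" where
  "chain_time 0 j = 0"
| "chain_time (Suc t) j = (if j = n + m then 0 else
     chain_time t j + (1 + up_rate n m rV j * (chain_time t (Suc j) - chain_time t j)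
       + down_rate n rU j * (chain_time t (j - 1) - chain_time t j)) / R)"

lemma nn_integral_capped_time:
  "admissible x \<Longrightarrow> 0 \<le> chain_time t (level x)
     \<and> (\<integral>\<^sup>+\<omega>. capped_time t V x \<omega> \<partial>\<Omega>) = ennreal (chain_time t (level x))"
proof (induction t arbitrary: x)
  case 0
  have "capped_time 0 V x = (\<lambda>_. 0)" by (rule ext) simp
  then show ?case by simp
next
  case (Suc t)
  show ?case
  proof (cases "x = V")
    case True
    then show ?thesis using level_top_iff[OF Suc(2)] by simp
  next
    case False
    have IH: "0 \<le> chain_time t (level (jump k x))"
      "(\<integral>\<^sup>+\<omega>. capped_time t V (jump k x) \<omega> \<partial>\<Omega>) = ennreal (chain_time t (level (jump k x)))"
      if "k \<in> clocks N" for k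
      using Suc(1)[OF admissible_jump[OF Suc(2) that]] by simp_all
    let ?S = "1 / R + (\<Sum>k\<in>clocks N. clock_rate rate k / R * chain_time t (level (jump k x)))"
    have term0: "0 \<le> clock_rate rate k / R * chain_time t (level (jump k x))" if "k \<in> clocks N" for k
      using IH(1)[OF that] rate_nonneg[OF that] total_pos by simp
    have S: "?S = chain_time (Suc t) (level x)"
      using jump_average_level[OF Suc(2), of "chain_time t"] False level_top_iff[OF Suc(2)] by simp
    have "(\<integral>\<^sup>+\<omega>. capped_time (Suc t) V x \<omega> \<partial>\<Omega>)
       = ennreal (1 / R) + (\<Sum>k\<in>clocks N. ennreal (clock_rate rate k / R) * ennreal (chain_time t (level (jump k x))))"
      unfolding nn_integral_capped_time_Suc[OF False] by (simp add: IH(2))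
    also have "(\<Sum>k\<in>clocks N. ennreal (clock_rate rate k / R) * ennreal (chain_time t (level (jump k x))))
       = (\<Sum>k\<in>clocks N. ennreal (clock_rate rate k / R * chain_time t (level (jump k x))))"
    proof (intro sum.cong refl)
      fix k assume k: "k \<in> clocks N"
      show "ennreal (clock_rate rate k / R) * ennreal (chain_time t (level (jump k x)))
          = ennreal (clock_rate rate k / R * chain_time t (level (jump k x)))"
        using IH(1)[OF k] rate_nonneg[OF k] total_pos by (intro ennreal_mult[symmetric] divide_nonneg_pos)
    qed
    also have "\<dots> = ennreal (\<Sum>k\<in>clocks N. clock_rate rate k / R * chain_time t (level (jump k x)))"
      by (rule sum_ennreal[OF term0])
    also have "ennreal (1 / R) + \<dots> = ennreal ?S"
      using total_pos term0 by (intro ennreal_plus[symmetric] sum_nonneg) auto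
    finally show ?thesis
      using total_pos term0 unfolding S[symmetric] by (auto intro!: add_nonneg_nonneg sum_nonneg)
  qed
qed

end

locale crossing_network = two_rate_network +
  assumes rV_pos: "0 < rV"
begin

abbreviation "passage \<equiv> passage_time n m rU rV"

definition remaining :: "nat \<Rightarrow> real" where
  "remaining j = (\<Sum>i=j..<n + m. passage i)"

lemma remaining_Suc: "j < n + m \<Longrightarrow> remaining j = passage j + remaining (Suc j)"
  unfolding remaining_def by (rule sum.atLeast_Suc_lessThan)

lemma passage_balance:
  assumes "j < n + m"
  shows "up_rate n m rV j * passage j = 1 + down_rate n rU j * (if j = 0 then 0 else passage (j - 1))"
  using up_rate_pos[OF rV_pos assms] by (cases j) (auto simp: down_rate_def)

lemma remaining_balance:
  assumes "j < n + m"
  shows "1 + up_rate n m rV j * (remaining (Suc j) - remaining j) + down_rate n rU j * (remaining (j - 1) - remaining j) = 0"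
proof (cases j)
  case 0
  then show ?thesis using passage_balance[OF assms] remaining_Suc[OF assms] by (simp add: down_rate_def)
next
  case (Suc i)
  then have "remaining (j - 1) - remaining j = passage i" using remaining_Suc[of i] assms by simp
  moreover have "remaining (Suc j) - remaining j = - passage j" using remaining_Suc[OF assms] by simp
  ultimately show ?thesis using passage_balance[OF assms] Suc by simp
qed

text \<open>
  The candidate solves the first-step equation exactly, so it dominates, by induction, the
  truncated times, which start from \<open>0\<close>.
\<close>
lemma chain_time_le: "admissible x \<Longrightarrow> chain_time t (level x) \<le> remaining (level x)"
proof (induction t arbitrary: x)
  case 0
  show ?case unfolding remaining_def using rates by (auto intro!: sum_nonneg passage_time_nonneg)
next
  case (Suc t)
  show ?case
  proof (cases "level x = n + m")
    case True
    then show ?thesis by (simp add: remaining_def)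
  next
    case False
    then have l: "level x < n + m" using level_le[OF Suc(2)] by simp
    have "chain_time (Suc t) (level x)
      = 1 / R + (\<Sum>k\<in>clocks N. clock_rate rate k / R * chain_time t (level (jump k x)))"
      using jump_average_level[OF Suc(2), of "chain_time t"] False by simp
    also have "\<dots> \<le> 1 / R + (\<Sum>k\<in>clocks N. clock_rate rate k / R * remaining (level (jump k x)))"
      using Suc(1)[OF admissible_jump[OF Suc(2)]] rate_nonneg total_pos
      by (intro add_left_mono sum_mono mult_left_mono) auto
    also have "\<dots> = remaining (level x)"
      unfolding jump_average_level[OF Suc(2), of remaining] remaining_balance[OF l] by simp
    finally show ?thesis .
  qed
qed

lemma chain_time_incseq: assumes "j \<le> n + m" shows "incseq (\<lambda>t. chain_time t j)"
proof (rule incseq_SucI)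
  fix t
  obtain x where x: "admissible x" "level x = j" using level_attained[OF assms] by blast
  have "(\<integral>\<^sup>+\<omega>. capped_time t V x \<omega> \<partial>\<Omega>) \<le> (\<integral>\<^sup>+\<omega>. capped_time (Suc t) V x \<omega> \<partial>\<Omega>)"
    by (intro nn_integral_mono capped_time_mono)
  then show "chain_time t j \<le> chain_time (Suc t) j"
    using nn_integral_capped_time[OF x(1), of t] nn_integral_capped_time[OF x(1), of "Suc t"] x(2)
    by (simp del: chain_time.simps)
qed

text \<open>
  The first-step equations alone have also the infinite solution; the bound \<open>chain_time_le\<close> makes
  the limit finite. For a finite solution the equations can be subtracted and determine the
  differences between neighbouring levels one after the other.
\<close>
lemma chain_time_tendsto: "(\<lambda>t. chain_time t 0) \<longlonglongrightarrow> crossing_time n m rU rV"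
proof -
  have "\<exists>l. (\<lambda>t. chain_time t j) \<longlonglongrightarrow> l" if j: "j \<le> n + m" for j
  proof -
    obtain x where x: "admissible x" "level x = j" using level_attained[OF j] by blast
    have "chain_time t j \<le> remaining j" for t using chain_time_le[OF x(1)] x(2) by simp
    then show ?thesis using incseq_convergent[OF chain_time_incseq[OF j]] by blast
  qed
  then obtain f where f: "\<And>j. j \<le> n + m \<Longrightarrow> (\<lambda>t. chain_time t j) \<longlonglongrightarrow> f j" by metis
  have f_top: "f (n + m) = 0"
  proof -
    have "(\<lambda>t. chain_time (Suc t) (n + m)) \<longlonglongrightarrow> f (n + m)" using f[of "n + m"] by (rule LIMSEQ_Suc) simp
    then show ?thesis using LIMSEQ_unique[OF _ tendsto_const[of 0]] by simp
  qed
  have balance: "up_rate n m rV j * (f j - f (Suc j)) = 1 + down_rate n rU j * (f (j - 1) - f j)" if j: "j < n + m" for j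
  proof -
    have "(\<lambda>t. chain_time (Suc t) j) \<longlonglongrightarrow> f j" using f[of j] j by (intro LIMSEQ_Suc) simp
    moreover have "(\<lambda>t. chain_time (Suc t) j) \<longlonglongrightarrow> f j + (1 + up_rate n m rV j * (f (Suc j) - f j)
       + down_rate n rU j * (f (j - 1) - f j)) / R"
      using j total_pos by (auto intro!: tendsto_intros f)
    ultimately have "f j = f j + (1 + up_rate n m rV j * (f (Suc j) - f j)
       + down_rate n rU j * (f (j - 1) - f j)) / R" by (rule LIMSEQ_unique)
    then show ?thesis using total_pos by (simp add: field_simps)
  qed
  have diff: "f j - f (Suc j) = passage j" if "j < n + m" for j
    using that
  proof (induction j)
    case 0
    then show ?case using balance[OF 0] passage_balance[OF 0] up_rate_pos[OF rV_pos 0]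
      by (simp add: down_rate_def field_simps)
  next
    case (Suc j)
    then have "up_rate n m rV (Suc j) * (f (Suc j) - f (Suc (Suc j))) = up_rate n m rV (Suc j) * passage (Suc j)"
      using balance[OF Suc(2)] passage_balance[OF Suc(2)] by simp
    then show ?case using up_rate_pos[OF rV_pos Suc(2)] by (simp del: passage_time.simps)
  qed
  have "crossing_time n m rU rV = (\<Sum>j<n + m. f j - f (Suc j))"
    unfolding crossing_time_def by (intro sum.cong) (auto simp: diff)
  also have "\<dots> = f 0" using sum_lessThan_telescope'[of f "n + m"] by (simp add: f_top)
  finally show ?thesis using f[of 0] by simp
qed

theorem mean_transition_time_eq:
  "mean_transition_time U V rate = ennreal (crossing_time n m rU rV)"
proof -
  have U: "admissible U" "level U = 0" by (auto simp: admissible_def level_U)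
  have "mean_transition_time U V rate = (\<integral>\<^sup>+\<omega>. hitting_time U V rate U V \<omega> \<partial>\<Omega>)"
    by (simp add: mean_transition_time_def clock_space_def)
  also have "\<dots> = (\<integral>\<^sup>+\<omega>. (SUP t. capped_time t V U \<omega>) \<partial>\<Omega>)"
    using AE_good by (intro nn_integral_cong_AE) (auto elim!: eventually_mono intro!: hitting_time_eq_SUP)
  also have "\<dots> = (SUP t. \<integral>\<^sup>+\<omega>. capped_time t V U \<omega> \<partial>\<Omega>)"
    by (intro nn_integral_monotone_convergence_SUP incseq_SucI le_funI capped_time_mono capped_time_measurable)
  also have "\<dots> = (SUP t. ennreal (chain_time t 0))"
    using nn_integral_capped_time[OF U(1)] by (simp add: U(2))
  also have "\<dots> = ennreal (crossing_time n m rU rV)"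
  proof (rule LIMSEQ_unique)
    show "(\<lambda>t. ennreal (chain_time t 0)) \<longlonglongrightarrow> (SUP t. ennreal (chain_time t 0))"
      using chain_time_incseq[of 0] by (intro LIMSEQ_SUP) (auto simp: incseq_def intro!: ennreal_leI)
    show "(\<lambda>t. ennreal (chain_time t 0)) \<longlonglongrightarrow> ennreal (crossing_time n m rU rV)"
      by (intro tendsto_ennrealI chain_time_tendsto)
  qed
  finally show ?thesis .
qed

end

text \<open>
  No node of \<open>V\<close> ever activates on any path, so \<open>V\<close> is not hit at all.
\<close>
lemma mean_transition_time_blocked:
  assumes "V \<noteq> {}" "U \<inter> V = {}" "\<And>i. i \<in> V \<Longrightarrow> a i = 0"
  shows "mean_transition_time U V a = \<top>"
proof -
  have upd: "update U V a \<omega> t x \<inter> V = {}" if "x \<inter> V = {}" for \<omega> t x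
    using that assms(3) by (auto simp: update_def clock_ticks_def)
  have "fold (update U V a \<omega>) ts x \<inter> V = {}" if "x \<inter> V = {}" for \<omega> ts x
    using that by (induction ts arbitrary: x) (auto simp: upd)
  then have "process U V a U \<omega> t \<noteq> V" for \<omega> t
    unfolding process_def using assms(1,2) by (metis Int_absorb)
  then have hit: "hitting_time U V a U V \<omega> = \<top>" for \<omega> by (simp add: hitting_time_def)
  interpret prob_space "clock_space (U \<union> V)"
    unfolding clock_space_def by (rule prob_space_exp_seqs)
  show ?thesis by (simp add: mean_transition_time_def hit emeasure_space_1)
qed

section \<open>Monotonicity, continuity and growth of the crossing time\<close>
lemma passage_time_mono:
  assumes "0 \<le> a" "a \<le> a'" "0 < b'" "b' \<le> b"
  shows "j < n + m \<Longrightarrow> passage_time n m a b j \<le> passage_time n m a' b' j"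
proof (induction j)
  case 0
  then show ?case using assms up_rate_pos[OF assms(3) 0]
    by (auto simp: up_rate_def intro!: divide_left_mono mult_left_mono)
next
  case (Suc j)
  have up: "0 < up_rate n m b' (Suc j)" "up_rate n m b' (Suc j) \<le> up_rate n m b (Suc j)"
    using assms up_rate_pos[OF assms(3) Suc(2)] by (auto simp: up_rate_def intro!: mult_left_mono)
  have down: "0 \<le> down_rate n a (Suc j)" "down_rate n a (Suc j) \<le> down_rate n a' (Suc j)"
    using assms by (auto simp: down_rate_def intro!: mult_left_mono)
  have "0 \<le> passage_time n m a b j" using assms by (intro passage_time_nonneg) auto
  then have "0 \<le> down_rate n a (Suc j) * passage_time n m a b j"
     and "down_rate n a (Suc j) * passage_time n m a b j \<le> down_rate n a' (Suc j) * passage_time n m a' b' j"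
    using Suc down by (auto intro!: mult_mono)
  with up show ?case by (auto intro!: frac_le)
qed

lemma crossing_time_mono:
  assumes "0 \<le> a" "a \<le> a'" "0 < b'" "b' \<le> b"
  shows "crossing_time n m a b \<le> crossing_time n m a' b'"
  unfolding crossing_time_def using passage_time_mono[OF assms] by (intro sum_mono) auto

lemma passage_time_le_crossing_time:
  assumes "0 \<le> a" "0 \<le> b" "j < n + m"
  shows "passage_time n m a b j \<le> crossing_time n m a b"
  unfolding crossing_time_def using assms by (intro member_le_sum passage_time_nonneg) auto

lemma crossing_time_pos:
  assumes "0 \<le> a" "0 \<le> b" "0 < n" shows "0 < crossing_time n m a b"
proof -
  have "0 < passage_time n m a b 0" using assms by (simp add: up_rate_def)
  also have "\<dots> \<le> crossing_time n m a b" using assms by (intro passage_time_le_crossing_time) auto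
  finally show ?thesis .
qed

text \<open>
  The inactive nodes of \<open>V\<close> together activate at rate at most \<open>m b\<close>, so leaving the empty
  configuration towards \<open>V\<close> takes at least the mean time \<open>1 / (m b)\<close>.
  This bound makes \<open>\<nu>\<close> continuous where the rate of \<open>V\<close> vanishes.
\<close>
lemma crossing_time_ge:
  assumes "0 \<le> a" "0 < b" "0 < n" "0 < m" shows "1 / (real m * b) \<le> crossing_time n m a b"
proof -
  obtain j where j: "n = Suc j" using assms(3) by (cases n) auto
  have "1 / (real m * b) \<le> passage_time n m a b n"
    using assms passage_time_nonneg[of a b n m j]
    by (simp add: j up_rate_def down_rate_nonneg divide_right_mono)
  also have "\<dots> \<le> crossing_time n m a b" using assms by (intro passage_time_le_crossing_time) auto
  finally show ?thesis .
qed

lemma tendsto_crossing_time: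
  assumes "(a \<longlongrightarrow> a0) F" "(b \<longlongrightarrow> b0) F" "0 < b0"
  shows "((\<lambda>x. crossing_time n m (a x) (b x)) \<longlongrightarrow> crossing_time n m a0 b0) F"
proof -
  have up: "((\<lambda>x. up_rate n m (b x) j) \<longlongrightarrow> up_rate n m b0 j) F" for j
    unfolding up_rate_def using assms by (auto intro!: tendsto_intros)
  have down: "((\<lambda>x. down_rate n (a x) j) \<longlongrightarrow> down_rate n a0 j) F" for j
    unfolding down_rate_def using assms by (auto intro!: tendsto_intros)
  have "((\<lambda>x. passage_time n m (a x) (b x) j) \<longlongrightarrow> passage_time n m a0 b0 j) F" if "j < n + m" for j
    using that
  proof (induction j)
    case 0
    then show ?case using up_rate_pos[OF assms(3) 0] by (auto intro!: tendsto_intros up)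
  next
    case (Suc j)
    then show ?case using up_rate_pos[OF assms(3) Suc(2)] by (auto intro!: tendsto_intros up down)
  qed
  then show ?thesis unfolding crossing_time_def by (intro tendsto_sum) auto
qed

text \<open>
  Below level \<open>n\<close> the recursion multiplies \<open>e\<^sub>j\<close> by \<open>(j + 1) a / (n - j - 1)\<close> up to lower order, so
  \<open>e\<^sub>j\<close> grows like \<open>a ^ j\<close>, with a coefficient that is \<open>1 / n\<close> for \<open>j = n - 1\<close>. At level \<open>n\<close>
  the recursion multiplies by a constant times \<open>a / b\<close>, and at each later level by a constant times
  \<open>1 / b\<close>; both tend to \<open>0\<close>.
\<close>
lemma crossing_time_asymptotics:
  assumes n: "0 < n" and a: "filterlim a at_top F" and ba: "filterlim (\<lambda>x. b x / a x) at_top F"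
  shows "((\<lambda>x. crossing_time n m (a x) (b x) / a x ^ (n - 1)) \<longlongrightarrow> 1 / real n) F"
proof -
  let ?p = "\<lambda>j x. passage_time n m (a x) (b x) j"
  have a0: "eventually (\<lambda>x. 1 < a x) F" using a by (simp add: filterlim_at_top_dense)
  have ia: "((\<lambda>x. inverse (a x)) \<longlongrightarrow> 0) F" using a by (rule tendsto_inverse_0_at_top)
  have iab: "((\<lambda>x. a x / b x) \<longlongrightarrow> 0) F" using tendsto_inverse_0_at_top[OF ba] by simp
  have b: "filterlim b at_top F"
  proof -
    have "filterlim (\<lambda>x. a x * (b x / a x)) at_top F"
      by (rule filterlim_at_top_mult_at_top[OF a ba])
    then show ?thesis
      by (rule filterlim_cong[THEN iffD1, OF refl refl, rotated])
         (use a0 in \<open>auto elim: eventually_mono\<close>)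
  qed
  have b0: "eventually (\<lambda>x. 0 < b x) F" using b by (simp add: filterlim_at_top_dense)
  have ib: "((\<lambda>x. inverse (b x)) \<longlongrightarrow> 0) F" using b by (rule tendsto_inverse_0_at_top)
  have low: "((\<lambda>x. ?p j x / a x ^ j) \<longlongrightarrow> fact j * fact (n - 1 - j) / fact n) F" if "j < n" for j
    using that
  proof (induction j)
    case 0
    have "fact (n - 1) / fact n = (1 / real n :: real)" using n by (simp add: fact_reduce[of n])
    then show ?case using n by (simp add: up_rate_def)
  next
    case (Suc j)
    define P where "P x = ?p j x / a x ^ j" for x
    define c :: real where "c = fact j * fact (n - 1 - j) / fact n"
    have IH: "(P \<longlongrightarrow> c) F" using Suc unfolding P_def c_def by simp
    have "((\<lambda>x. (inverse (a x) ^ Suc j + real (Suc j) * P x) / real (n - Suc j))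
       \<longlongrightarrow> (0 ^ Suc j + real (Suc j) * c) / real (n - Suc j)) F"
      using Suc(2) by (intro tendsto_intros ia IH) auto
    moreover have "eventually (\<lambda>x. (inverse (a x) ^ Suc j + real (Suc j) * P x) / real (n - Suc j)
       = ?p (Suc j) x / a x ^ Suc j) F"
      using a0 by eventually_elim (use Suc(2) in \<open>simp add: P_def up_rate_def down_rate_def field_simps\<close>)
    moreover have "(0 ^ Suc j + real (Suc j) * c) / real (n - Suc j)
       = (fact (Suc j) * fact (n - 1 - Suc j) / fact n :: real)"
    proof -
      obtain k where k: "n - 1 - j = Suc k" "n - Suc j = Suc k" "n - 1 - Suc j = k"
        using Suc(2) less_imp_Suc_add[OF Suc(2)] by auto
      show ?thesis unfolding c_def k by (simp add: field_simps del: of_nat_Suc)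
    qed
    ultimately show ?case by (simp only: tendsto_cong)
  qed
  have mid: "((\<lambda>x. ?p j x / a x ^ (n - 1)) \<longlongrightarrow> 0) F" if "Suc j < n" for j
  proof -
    have "((\<lambda>x. ?p j x / a x ^ j * inverse (a x) ^ (n - 1 - j)) \<longlongrightarrow> fact j * fact (n - 1 - j) / fact n * 0 ^ (n - 1 - j)) F"
      using that by (intro tendsto_mult low tendsto_power ia) auto
    moreover have "eventually (\<lambda>x. ?p j x / a x ^ j * inverse (a x) ^ (n - 1 - j) = ?p j x / a x ^ (n - 1)) F"
      using a0
    proof eventually_elim
      case (elim x)
      have "a x ^ (n - 1) = a x ^ j * a x ^ (n - 1 - j)" using that by (simp flip: power_add)
      then show ?case by (simp add: field_simps)
    qed
    ultimately show ?thesis using that by (simp add: tendsto_cong power_0_left)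
  qed
  have top: "((\<lambda>x. ?p (n - 1) x / a x ^ (n - 1)) \<longlongrightarrow> 1 / real n) F"
    using low[of "n - 1"] n by (simp add: fact_reduce[of n])
  have high: "((\<lambda>x. ?p (n + i) x / a x ^ (n - 1)) \<longlongrightarrow> 0) F" if "i < m" for i
    using that
  proof (induction i)
    case 0
    obtain k where k: "n = Suc k" using n by (cases n) auto
    define P where "P x = ?p (n - 1) x / a x ^ (n - 1)" for x
    define Q where "Q x = a x / b x" for x
    have lims: "(P \<longlongrightarrow> 1 / real n) F" "(Q \<longlongrightarrow> 0) F" using top iab unfolding P_def Q_def .
    have "((\<lambda>x. inverse (b x) * inverse (a x) ^ (n - 1) / real m + real n / real m * Q x * P x)
        \<longlongrightarrow> 0 * 0 ^ (n - 1) / real m + real n / real m * 0 * (1 / real n)) F"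
      using 0 by (intro tendsto_intros ia ib lims) auto
    moreover have "eventually (\<lambda>x. inverse (b x) * inverse (a x) ^ (n - 1) / real m + real n / real m * Q x * P x
       = ?p (n + 0) x / a x ^ (n - 1)) F"
      using a0 b0 by eventually_elim (use 0 in \<open>simp add: P_def Q_def k up_rate_def down_rate_def field_simps\<close>)
    ultimately show ?case by (simp add: tendsto_cong)
  next
    case (Suc i)
    let ?u = "real (m - Suc i)"
    define P where "P x = ?p (n + i) x / a x ^ (n - 1)" for x
    have IH: "(P \<longlongrightarrow> 0) F" using Suc unfolding P_def by simp
    have "((\<lambda>x. inverse (b x) / ?u * (inverse (a x) ^ (n - 1) + real (Suc i) * P x))
        \<longlongrightarrow> 0 / ?u * (0 ^ (n - 1) + real (Suc i) * 0)) F"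
      using Suc(2) by (intro tendsto_intros ia ib IH) auto
    moreover have "eventually (\<lambda>x. inverse (b x) / ?u * (inverse (a x) ^ (n - 1) + real (Suc i) * P x)
       = ?p (n + Suc i) x / a x ^ (n - 1)) F"
      using a0 b0 by eventually_elim (use Suc(2) in \<open>simp add: P_def up_rate_def down_rate_def field_simps\<close>)
    ultimately show ?case by (simp add: tendsto_cong)
  qed
  have "((\<lambda>x. \<Sum>j<n + m. ?p j x / a x ^ (n - 1)) \<longlongrightarrow> (\<Sum>j<n + m. if j = n - 1 then 1 / real n else 0)) F"
  proof (rule tendsto_sum)
    fix j assume j: "j \<in> {..<n + m}"
    consider "Suc j < n" | "j = n - 1" | "n \<le> j" using n by linarith
    then show "((\<lambda>x. ?p j x / a x ^ (n - 1)) \<longlongrightarrow> (if j = n - 1 then 1 / real n else 0)) F"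
    proof cases
      case 1
      then have "j \<noteq> n - 1" by linarith
      then show ?thesis using mid[OF 1] by simp
    next
      case 2
      then show ?thesis using top by simp
    next
      case 3
      then show ?thesis using high[of "j - n"] j n by auto
    qed
  qed
  moreover have "n - 1 < n + m" using n by simp
  ultimately show ?thesis by (simp add: crossing_time_def sum_divide_distrib sum.delta)
qed

section \<open>Existence and uniqueness of the critical time\<close>
locale frozen_rates =
  fixes U V :: "'a set" and rU rV :: "real \<Rightarrow> real"
  assumes fin: "finite U" "finite V" and ne: "U \<noteq> {}" "V \<noteq> {}" and disj: "U \<inter> V = {}"
    and cont: "continuous_on UNIV rU" "continuous_on UNIV rV"
    and nonneg: "\<And>s. 0 \<le> rU s" "\<And>s. 0 \<le> rV s"
    and antimono_rU: "antimono rU" and mono_rV: "mono rV"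
    and rV_eventually_pos: "\<exists>s. 0 < rV s"
begin

definition D :: "real \<Rightarrow> real" where
  "D s = crossing_time (card U) (card V) (rU s) (rV s)"

lemma cards: "0 < card U" "0 < card V"
  using fin ne by (auto simp: card_gt_0_iff)

lemma D_pos: "0 < D s"
  unfolding D_def using nonneg cards by (intro crossing_time_pos) auto

lemma nu_eq: "nu U V rU rV s = (if rV s = 0 then 0 else 1 / D s)"
proof (cases "rV s = 0")
  case True
  have "mean_transition_time U V (\<lambda>i. if i \<in> U then rU s else rV s) = \<top>"
    using ne disj True by (intro mean_transition_time_blocked) auto
  then show ?thesis using True by (simp add: nu_def)
next
  case False
  interpret crossing_network U V "rU s" "rV s"
    by unfold_locales (use fin ne disj nonneg False in \<open>auto simp: less_le\<close>)
  show ?thesis using False D_pos[of s] unfolding nu_def mean_transition_time_eq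
    by (simp add: D_def divide_ennreal flip: ennreal_1)
qed

lemma nu_mono: "mono (nu U V rU rV)"
proof (rule monoI)
  fix s t :: real assume "s \<le> t"
  then have le: "rU t \<le> rU s" "rV s \<le> rV t"
    using antimono_rU mono_rV by (auto dest: antimonoD monoD)
  show "nu U V rU rV s \<le> nu U V rU rV t"
  proof (cases "rV s = 0")
    case True
    then show ?thesis using D_pos[of t] by (simp add: nu_eq)
  next
    case False
    then have "0 < rV s" using nonneg[of s] by simp
    moreover from this have "D t \<le> D s"
      unfolding D_def using le nonneg by (intro crossing_time_mono) auto
    ultimately show ?thesis using le D_pos by (auto simp: nu_eq intro!: divide_left_mono)
  qed
qed

text \<open>
  At a zero of \<open>rV\<close>, where the mean transition time is infinite, \<open>crossing_time_ge\<close> gives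
  \<open>\<nu>(t) \<le> |V| rV(t)\<close> nearby.
\<close>
lemma nu_isCont: "isCont (nu U V rU rV) s"
proof (cases "rV s = 0")
  case True
  have "((\<lambda>t. real (card V) * rV t) \<longlongrightarrow> real (card V) * rV s) (at s)"
    using cont by (intro tendsto_intros) (simp add: continuous_on_eq_continuous_at isCont_def)
  then have lim: "((\<lambda>t. real (card V) * rV t) \<longlongrightarrow> 0) (at s)" using True by simp
  have "0 \<le> nu U V rU rV t \<and> nu U V rU rV t \<le> real (card V) * rV t" for t
  proof (cases "rV t = 0")
    case False
    then have p: "0 < rV t" using nonneg[of t] by simp
    have "1 / (real (card V) * rV t) \<le> D t"
      unfolding D_def using p cards nonneg by (intro crossing_time_ge) auto
    then show ?thesis using D_pos[of t] p cards by (simp add: nu_eq field_simps)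
  qed (simp add: nu_eq)
  then have "(nu U V rU rV \<longlongrightarrow> 0) (at s)"
    by (intro tendsto_sandwich[OF _ _ tendsto_const lim]) auto
  then show ?thesis using True by (simp add: isCont_def nu_eq)
next
  case False
  then have p: "0 < rV s" using nonneg[of s] by simp
  have lims: "(rU \<longlongrightarrow> rU s) (at s)" "(rV \<longlongrightarrow> rV s) (at s)"
    using cont by (simp_all add: continuous_on_eq_continuous_at isCont_def)
  have "(D \<longlongrightarrow> D s) (at s)" unfolding D_def by (rule tendsto_crossing_time[OF lims p])
  then have "((\<lambda>t. 1 / D t) \<longlongrightarrow> 1 / D s) (at s)" using D_pos[of s] by (intro tendsto_intros) auto
  moreover have "eventually (\<lambda>t. 1 / D t = nu U V rU rV t) (at s)"
    using order_tendstoD(1)[OF lims(2) p] by eventually_elim (simp add: nu_eq)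
  ultimately have "(nu U V rU rV \<longlongrightarrow> 1 / D s) (at s)" by (rule Lim_transform_eventually)
  then show ?thesis using False by (simp add: isCont_def nu_eq)
qed

lemma critical_time_unique:
  assumes "is_critical_time U V rU rV M" "is_critical_time U V rU rV M'" shows "M = M'"
proof -
  have "M' \<le> M" if "is_critical_time U V rU rV M" "is_critical_time U V rU rV M'" for M M'
  proof (rule ccontr)
    assume "\<not> M' \<le> M"
    then have l: "M < M'" by simp
    have M: "0 \<le> M" "M * nu U V rU rV M = 1" "M' * nu U V rU rV M' = 1"
      using that by (auto simp: is_critical_time_def)
    then have "0 < M * nu U V rU rV M" by simp
    then have "0 < nu U V rU rV M" using M(1) by (auto simp: zero_less_mult_iff)
    then have "M * nu U V rU rV M < M' * nu U V rU rV M" using l by simp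
    also have "\<dots> \<le> M' * nu U V rU rV M'" using l M by (intro mult_left_mono monoD[OF nu_mono]) auto
    finally show False using M by simp
  qed
  then show ?thesis using assms by (meson antisym)
qed

text \<open>
  Intermediate values of \<open>s \<nu>(s)\<close> between \<open>0\<close> and \<open>S\<close>, where \<open>S\<close> is at least the mean transition
  time at some point \<open>s0 \<le> S\<close>.
\<close>
lemma critical_time_exists: "\<exists>M. is_critical_time U V rU rV M"
proof -
  obtain s0 where s0: "0 < rV s0" using rV_eventually_pos by blast
  define S where "S = max s0 (D s0)"
  have nu0: "1 / D s0 \<le> nu U V rU rV S"
    using monoD[OF nu_mono, of s0 S] s0 by (simp add: nu_eq[of s0] S_def)
  have S: "0 \<le> S" "D s0 \<le> S" using D_pos[of s0] by (auto simp: S_def)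
  have "1 = D s0 * (1 / D s0)" using D_pos[of s0] by simp
  also have "\<dots> \<le> S * nu U V rU rV S" using nu0 S D_pos[of s0] by (intro mult_mono) auto
  finally have "1 \<le> S * nu U V rU rV S" .
  then have "\<exists>M\<ge>0. M \<le> S \<and> M * nu U V rU rV M = 1"
    using S(1) nu_isCont by (intro IVT) (auto intro!: continuous_intros)
  then show ?thesis by (auto simp: is_critical_time_def)
qed

lemma ex1_critical_time: "\<exists>!M. is_critical_time U V rU rV M"
  using critical_time_exists critical_time_unique by blast

lemma critical_time_spec: "is_critical_time U V rU rV (critical_time U V rU rV)"
  unfolding critical_time_def by (rule theI'[OF ex1_critical_time])

text \<open>
  The critical time is the fixed point of the nonincreasing mean transition time \<open>D\<close>. With
  \<open>critical_time_ge\<close>, comparing \<open>D s\<close> with \<open>s\<close> decides on which side of \<open>s\<close> it lies.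
\<close>
lemma critical_time_le:
  assumes "0 < rV s" "D s \<le> s" shows "critical_time U V rU rV \<le> s"
proof (rule ccontr)
  let ?M = "critical_time U V rU rV"
  assume "\<not> ?M \<le> s"
  then have l: "s < ?M" by simp
  have M: "0 \<le> ?M" "?M * nu U V rU rV ?M = 1" using critical_time_spec by (auto simp: is_critical_time_def)
  have "1 \<le> s * nu U V rU rV s" using assms D_pos[of s] by (simp add: nu_eq)
  also have "\<dots> < ?M * nu U V rU rV s" using l assms D_pos[of s] by (simp add: nu_eq divide_strict_right_mono)
  also have "\<dots> \<le> ?M * nu U V rU rV ?M" using l M by (intro mult_left_mono monoD[OF nu_mono]) auto
  finally show False using M by simp
qed

lemma critical_time_ge:
  assumes "s \<le> D s" shows "s \<le> critical_time U V rU rV"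
proof (rule ccontr)
  let ?M = "critical_time U V rU rV"
  assume "\<not> s \<le> ?M"
  then have l: "?M < s" by simp
  have M: "0 \<le> ?M" "?M * nu U V rU rV ?M = 1" using critical_time_spec by (auto simp: is_critical_time_def)
  have "?M * nu U V rU rV ?M \<le> ?M * nu U V rU rV s" using l M by (intro mult_left_mono monoD[OF nu_mono]) auto
  also have "\<dots> \<le> ?M * (1 / D s)" using M D_pos[of s] by (intro mult_left_mono) (auto simp: nu_eq)
  also have "\<dots> < s * (1 / D s)" using l D_pos[of s] by (intro mult_strict_right_mono) auto
  also have "\<dots> \<le> 1" using assms D_pos[of s] by simp
  finally show False using M by simp
qed

end

section \<open>Asymptotics of the critical time in the external model\<close>
lemma class_GD:
  assumes "g \<in> class_G"
  shows "continuous_on UNIV g" "mono g" "0 \<le> g x" "x \<le> 0 \<Longrightarrow> g x = 0" "filterlim g at_top at_top"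
  using assms by (auto simp: class_G_def)

lemma filterlim_eventually_eq:
  assumes "filterlim f G F" "eventually (\<lambda>x. f x = g x) F" shows "filterlim g G F"
  by (rule iffD1[OF filterlim_cong[OF refl refl assms(2)] assms(1)])

lemma filterlim_powr_at_top:
  assumes "0 < (e :: real)" shows "filterlim (\<lambda>r. r powr e) at_top at_top"
proof -
  have "filterlim (\<lambda>r. exp (e * ln r)) at_top at_top"
    by (intro filterlim_compose[OF exp_at_top] filterlim_tendsto_pos_mult_at_top[OF tendsto_const assms] ln_at_top)
  moreover have "eventually (\<lambda>r. exp (e * ln r) = r powr e) at_top"
    using eventually_gt_at_top[of 0] by eventually_elim (simp add: powr_def)
  ultimately show ?thesis by (rule filterlim_eventually_eq)
qed

lemma regular_variation_along:
  fixes g y :: "real \<Rightarrow> real"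
  assumes g: "g \<sim>[at_top] (\<lambda>x. G * x powr \<beta>)" and "0 < G" "0 < \<theta>"
    and y: "((\<lambda>r. y r / r) \<longlongrightarrow> \<theta>) at_top"
  shows "((\<lambda>r. g (y r) / r powr \<beta>) \<longlongrightarrow> G * \<theta> powr \<beta>) at_top"
proof -
  have y_top: "filterlim y at_top at_top"
  proof -
    have "filterlim (\<lambda>r. y r / r * r) at_top at_top"
      by (rule filterlim_tendsto_pos_mult_at_top[OF y \<open>0 < \<theta>\<close> filterlim_ident])
    moreover have "eventually (\<lambda>r. y r / r * r = y r) at_top"
      using eventually_gt_at_top[of 0] by eventually_elim simp
    ultimately show ?thesis by (rule filterlim_eventually_eq)
  qed
  have pos: "eventually (\<lambda>r. 0 < y r) at_top" using y_top by (simp add: filterlim_at_top_dense)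
  have "((\<lambda>x. g x / (G * x powr \<beta>)) \<longlongrightarrow> 1) at_top"
    using asymp_equivD_strong[OF g] \<open>0 < G\<close>
    by (auto intro: eventually_mono[OF eventually_gt_at_top[of 0]])
  then have "((\<lambda>r. g (y r) / (G * y r powr \<beta>)) \<longlongrightarrow> 1) at_top"
    by (rule filterlim_compose[OF _ y_top])
  then have "((\<lambda>r. g (y r) / (G * y r powr \<beta>) * (G * (y r / r) powr \<beta>)) \<longlongrightarrow> 1 * (G * \<theta> powr \<beta>)) at_top"
    using \<open>0 < \<theta>\<close> by (intro tendsto_mult tendsto_const tendsto_powr[OF y]) auto
  moreover have "eventually (\<lambda>r. g (y r) / (G * y r powr \<beta>) * (G * (y r / r) powr \<beta>) = g (y r) / r powr \<beta>) at_top"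
    using pos eventually_gt_at_top[of 0]
    by eventually_elim (use \<open>0 < G\<close> in \<open>simp add: powr_divide field_simps\<close>)
  ultimately show ?thesis by (simp add: tendsto_cong)
qed

locale external_model =
  fixes U V :: "'a set" and gU gV :: "real \<Rightarrow> real"
    and c \<rho>U \<rho>V \<gamma>U \<gamma>V \<beta> G :: real
  assumes sets: "finite U" "finite V" "U \<noteq> {}" "V \<noteq> {}" "U \<inter> V = {}"
    and params: "c > \<rho>U" "\<rho>V > 0" "\<gamma>U > 0" "\<gamma>V > 0"
    and gU: "gU \<in> class_G" and gV: "gV \<in> class_G"
    and dominance: "filterlim (\<lambda>x. gV x / gU x) at_top at_top"
    and card_U: "card U \<ge> 2"
    and growth: "\<beta> > 0" "G > 0" "gU \<sim>[at_top] (\<lambda>x. G * x powr \<beta>)"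
begin

abbreviation "n \<equiv> card U"
abbreviation "m \<equiv> card V"
abbreviation "rate_U \<equiv> external_rate_U gU \<gamma>U c \<rho>U"
abbreviation "rate_V \<equiv> external_rate_V gV \<gamma>V \<rho>V"
abbreviation "M \<equiv> (\<lambda>r. critical_time U V (rate_U r) (rate_V r))"
abbreviation "p \<equiv> min 1 (\<beta> * (real n - 1))"
abbreviation "F \<equiv> critical_const n \<beta> G \<gamma>U c \<rho>U"

definition crossing :: "real \<Rightarrow> real \<Rightarrow> real" where
  "crossing r s = crossing_time n m (rate_U r s) (rate_V r s)"

lemma frozen: "frozen_rates U V (rate_U r) (rate_V r)"
proof
  have "continuous_on UNIV (\<lambda>t. gU (\<gamma>U * r - (c - \<rho>U) * t))"
    by (intro continuous_on_compose2[OF class_GD(1)[OF gU]] continuous_intros) auto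
  then show "continuous_on UNIV (rate_U r)" by (simp add: external_rate_U_def[abs_def])
  have "continuous_on UNIV (\<lambda>t. gV (\<gamma>V * r + \<rho>V * t))"
    by (intro continuous_on_compose2[OF class_GD(1)[OF gV]] continuous_intros) auto
  then show "continuous_on UNIV (rate_V r)" by (simp add: external_rate_V_def[abs_def])
  show "antimono (rate_U r)"
    using params by (intro antimonoI) (auto simp: external_rate_U_def intro!: monoD[OF class_GD(2)[OF gU]] mult_left_mono)
  show "mono (rate_V r)"
    using params by (intro monoI) (auto simp: external_rate_V_def intro!: monoD[OF class_GD(2)[OF gV]] mult_left_mono)
  have "eventually (\<lambda>x. 0 < gV x) at_top"
    using class_GD(5)[OF gV] by (simp add: filterlim_at_top_dense)
  then obtain x where x: "0 < gV x" by (auto simp: eventually_at_top_linorder)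
  then show "\<exists>s. 0 < rate_V r s"
    using params by (intro exI[of _ "(x - \<gamma>V * r) / \<rho>V"]) (simp add: external_rate_V_def)
qed (use sets in \<open>auto simp: external_rate_U_def external_rate_V_def class_GD(3)[OF gU] class_GD(3)[OF gV]\<close>)

lemma critical_le: "0 < rate_V r s \<Longrightarrow> crossing r s \<le> s \<Longrightarrow> M r \<le> s"
  using frozen_rates.critical_time_le[OF frozen] frozen_rates.D_def[OF frozen] by (simp add: crossing_def)

lemma critical_ge: "s \<le> crossing r s \<Longrightarrow> s \<le> M r"
  using frozen_rates.critical_time_ge[OF frozen] frozen_rates.D_def[OF frozen] by (simp add: crossing_def)

lemma rate_V_at_top:
  assumes "eventually (\<lambda>r. 0 \<le> s r) at_top"
  shows "filterlim (\<lambda>r. rate_V r (s r)) at_top at_top"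
proof (rule filterlim_at_top_mono)
  have "filterlim (\<lambda>r. \<gamma>V * r) at_top at_top"
    by (rule filterlim_tendsto_pos_mult_at_top[OF tendsto_const params(4) filterlim_ident])
  then show "filterlim (\<lambda>r. gV (\<gamma>V * r)) at_top at_top"
    by (rule filterlim_compose[OF class_GD(5)[OF gV]])
  show "eventually (\<lambda>r. gV (\<gamma>V * r) \<le> rate_V r (s r)) at_top"
    using assms by eventually_elim
      (use params in \<open>auto simp: external_rate_V_def intro!: monoD[OF class_GD(2)[OF gV]]\<close>)
qed

text \<open>
  Along \<open>s\<close> the rate of \<open>U\<close> grows like \<open>G (\<theta> r) powr \<beta>\<close>. The rate of \<open>V\<close> dominates it, because
  it is at least \<open>gV (\<gamma>V r)\<close>, which dominates \<open>gU (\<gamma>V r)\<close>, and the latter has the same order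
  \<open>r powr \<beta>\<close>.
\<close>
lemma crossing_asymptotics:
  assumes s: "eventually (\<lambda>r. 0 \<le> s r) at_top" and "0 < \<theta>"
    and \<theta>: "((\<lambda>r. (\<gamma>U * r - (c - \<rho>U) * s r) / r) \<longlongrightarrow> \<theta>) at_top"
  shows "((\<lambda>r. crossing r (s r) / r powr (\<beta> * (real n - 1)))
     \<longlongrightarrow> G powr (real n - 1) * \<theta> powr (\<beta> * (real n - 1)) / real n) at_top"
proof -
  define a where "a r = rate_U r (s r)" for r
  define b where "b r = rate_V r (s r)" for r
  have a_lim: "((\<lambda>r. a r / r powr \<beta>) \<longlongrightarrow> G * \<theta> powr \<beta>) at_top"
    unfolding a_def external_rate_U_def by (rule regular_variation_along[OF growth(3,2) \<open>0 < \<theta>\<close> \<theta>])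
  have pw: "filterlim (\<lambda>r::real. r powr \<beta>) at_top at_top"
    by (rule filterlim_powr_at_top[OF growth(1)])
  have "filterlim (\<lambda>r. a r / r powr \<beta> * r powr \<beta>) at_top at_top"
    by (rule filterlim_tendsto_pos_mult_at_top[OF a_lim _ pw]) (use growth \<open>0 < \<theta>\<close> in simp)
  moreover have "eventually (\<lambda>r. a r / r powr \<beta> * r powr \<beta> = a r) at_top"
    using eventually_gt_at_top[of 0] by eventually_elim simp
  ultimately have a: "filterlim a at_top at_top" by (rule filterlim_eventually_eq)
  have a0: "eventually (\<lambda>r. 0 < a r) at_top" using a by (simp add: filterlim_at_top_dense)
  have gV_top: "filterlim (\<lambda>r. \<gamma>V * r) at_top at_top"
    by (rule filterlim_tendsto_pos_mult_at_top[OF tendsto_const params(4) filterlim_ident])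
  have ratio_top: "filterlim (\<lambda>r. gV (\<gamma>V * r) / gU (\<gamma>V * r)) at_top at_top"
    by (rule filterlim_compose[OF dominance gV_top])
  have gU_lim: "((\<lambda>r. gU (\<gamma>V * r) / r powr \<beta>) \<longlongrightarrow> G * \<gamma>V powr \<beta>) at_top"
  proof (rule regular_variation_along[OF growth(3,2) params(4)])
    show "((\<lambda>r. \<gamma>V * r / r) \<longlongrightarrow> \<gamma>V) at_top"
    proof (rule tendsto_eventually)
      show "eventually (\<lambda>r. \<gamma>V * r / r = \<gamma>V) at_top"
        using eventually_gt_at_top[of 0] by eventually_elim simp
    qed
  qed
  have gU_pos: "eventually (\<lambda>r. 0 < gU (\<gamma>V * r)) at_top"
    using filterlim_compose[OF class_GD(5)[OF gU] gV_top] by (simp add: filterlim_at_top_dense)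
  \<comment> \<open>The quotient \<open>b / a\<close> is at least \<open>gU (\<gamma>V r) / a r\<close>, which has a positive limit,
    times \<open>(gV / gU) (\<gamma>V r)\<close>, which tends to infinity.\<close>
  have "((\<lambda>r. (gU (\<gamma>V * r) / r powr \<beta>) / (a r / r powr \<beta>)) \<longlongrightarrow> (G * \<gamma>V powr \<beta>) / (G * \<theta> powr \<beta>)) at_top"
    using growth \<open>0 < \<theta>\<close> by (intro tendsto_divide[OF gU_lim a_lim]) simp
  then have "filterlim (\<lambda>r. (gU (\<gamma>V * r) / r powr \<beta>) / (a r / r powr \<beta>) * (gV (\<gamma>V * r) / gU (\<gamma>V * r))) at_top at_top"
    by (rule filterlim_tendsto_pos_mult_at_top[OF _ _ ratio_top])
       (use growth \<open>0 < \<theta>\<close> params in simp)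
  moreover have "eventually (\<lambda>r. (gU (\<gamma>V * r) / r powr \<beta>) / (a r / r powr \<beta>) * (gV (\<gamma>V * r) / gU (\<gamma>V * r)) \<le> b r / a r) at_top"
    using a0 gU_pos eventually_gt_at_top[of 0] s
  proof eventually_elim
    case (elim r)
    have "gV (\<gamma>V * r) \<le> b r"
      using elim params by (auto simp: b_def external_rate_V_def intro!: monoD[OF class_GD(2)[OF gV]])
    then have "gV (\<gamma>V * r) / a r \<le> b r / a r" using elim by (intro divide_right_mono) auto
    then show ?case using elim by simp
  qed
  ultimately have ba: "filterlim (\<lambda>r. b r / a r) at_top at_top" by (rule filterlim_at_top_mono)
  have n: "0 < n" using card_U by simp
  have "((\<lambda>r. crossing_time n m (a r) (b r) / a r ^ (n - 1) * (a r / r powr \<beta>) ^ (n - 1))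
      \<longlongrightarrow> 1 / real n * (G * \<theta> powr \<beta>) ^ (n - 1)) at_top"
    by (intro tendsto_mult tendsto_power a_lim crossing_time_asymptotics[OF n a ba])
  moreover have "eventually (\<lambda>r. crossing_time n m (a r) (b r) / a r ^ (n - 1) * (a r / r powr \<beta>) ^ (n - 1)
      = crossing r (s r) / r powr (\<beta> * (real n - 1))) at_top"
    using a0 eventually_gt_at_top[of 0]
  proof eventually_elim
    case (elim r)
    have "(r powr \<beta>) ^ (n - 1) = r powr (\<beta> * (real n - 1))"
      using elim n by (simp add: powr_realpow[symmetric] powr_powr of_nat_diff)
    then show ?case using elim by (simp add: crossing_def a_def b_def power_divide)
  qed
  moreover have "(G * \<theta> powr \<beta>) ^ (n - 1) = G powr (real n - 1) * \<theta> powr (\<beta> * (real n - 1))"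
    using growth \<open>0 < \<theta>\<close> n by (simp add: powr_realpow[symmetric] powr_mult powr_powr of_nat_diff)
  ultimately show ?thesis by (simp add: tendsto_cong)
qed

text \<open>
  An upper bound is needed only for \<open>\<kappa>\<close> close to \<open>L\<close>; the restriction \<open>\<kappa> < K\<close> keeps the argument of
  \<open>gU\<close> positive where that matters.
\<close>
lemma critical_time_limit:
  assumes lower: "\<And>\<kappa>. 0 < \<kappa> \<Longrightarrow> \<kappa> < L \<Longrightarrow> eventually (\<lambda>r. \<kappa> * r powr p \<le> crossing r (\<kappa> * r powr p)) at_top"
    and upper: "\<And>\<kappa>. L < \<kappa> \<Longrightarrow> \<kappa> < K \<Longrightarrow> eventually (\<lambda>r. crossing r (\<kappa> * r powr p) \<le> \<kappa> * r powr p) at_top"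
    and "0 < L" "L < K"
  shows "((\<lambda>r. M r / r powr p) \<longlongrightarrow> L) at_top"
proof (rule order_tendstoI)
  fix x assume "x < L"
  then have "max 0 x < L" using \<open>0 < L\<close> by simp
  then obtain \<kappa> where k: "max 0 x < \<kappa>" "\<kappa> < L" using dense by blast
  then have "eventually (\<lambda>r. \<kappa> * r powr p \<le> crossing r (\<kappa> * r powr p)) at_top" by (intro lower) auto
  then show "eventually (\<lambda>r. x < M r / r powr p) at_top"
    using eventually_gt_at_top[of 0]
  proof eventually_elim
    case (elim r)
    have "\<kappa> * r powr p \<le> M r" by (rule critical_ge) (rule elim)
    then have "\<kappa> \<le> M r / r powr p" using elim by (simp add: pos_le_divide_eq)
    then show ?case using k by simp
  qed
next
  fix x assume "L < x"
  then have "L < min x K" using \<open>L < K\<close> by simp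
  then obtain \<kappa> where k: "L < \<kappa>" "\<kappa> < min x K" using dense by blast
  then have "eventually (\<lambda>r. crossing r (\<kappa> * r powr p) \<le> \<kappa> * r powr p) at_top" by (intro upper) auto
  moreover have "eventually (\<lambda>r. 0 < rate_V r (\<kappa> * r powr p)) at_top"
    using rate_V_at_top[of "\<lambda>r. \<kappa> * r powr p"] k \<open>0 < L\<close> by (simp add: filterlim_at_top_dense)
  ultimately show "eventually (\<lambda>r. M r / r powr p < x) at_top"
    using eventually_gt_at_top[of 0]
  proof eventually_elim
    case (elim r)
    have "M r \<le> \<kappa> * r powr p" by (rule critical_le) (rule elim)+
    then have "M r / r powr p \<le> \<kappa>" using elim by (simp add: pos_divide_le_eq)
    then show ?case using k by simp
  qed
qed

lemma eventually_scaled: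
  assumes "((\<lambda>r. crossing r (\<kappa> * r powr p) / r powr p) \<longlongrightarrow> l) at_top"
  shows "\<kappa> < l \<Longrightarrow> eventually (\<lambda>r. \<kappa> * r powr p \<le> crossing r (\<kappa> * r powr p)) at_top"
    and "l < \<kappa> \<Longrightarrow> eventually (\<lambda>r. crossing r (\<kappa> * r powr p) \<le> \<kappa> * r powr p) at_top"
proof -
  assume "\<kappa> < l"
  from order_tendstoD(1)[OF assms this] eventually_gt_at_top[of 0]
  show "eventually (\<lambda>r. \<kappa> * r powr p \<le> crossing r (\<kappa> * r powr p)) at_top"
    by eventually_elim (simp add: pos_less_divide_eq)
next
  assume "l < \<kappa>"
  from order_tendstoD(2)[OF assms this] eventually_gt_at_top[of 0]
  show "eventually (\<lambda>r. crossing r (\<kappa> * r powr p) \<le> \<kappa> * r powr p) at_top"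
    by eventually_elim (simp add: pos_divide_less_eq)
qed

lemma linear_scale_slope:
  assumes "p = 1"
  shows "((\<lambda>r. (\<gamma>U * r - (c - \<rho>U) * (\<kappa> * r powr p)) / r) \<longlongrightarrow> \<gamma>U - (c - \<rho>U) * \<kappa>) at_top"
proof (rule tendsto_eventually)
  show "eventually (\<lambda>r. (\<gamma>U * r - (c - \<rho>U) * (\<kappa> * r powr p)) / r = \<gamma>U - (c - \<rho>U) * \<kappa>) at_top"
    unfolding assms using eventually_gt_at_top[of 0] by eventually_elim (simp add: field_simps)
qed

lemma G_powr_minus: "G powr - (real n - 1) = 1 / G powr (real n - 1)"
  by (rule powr_minus_divide)

text \<open>
  Here \<open>\<kappa> r\<^sup>p\<close> is of smaller order than \<open>r\<close>, so that \<open>\<theta> = \<gamma>U\<close> for every \<open>\<kappa>\<close>, and the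
  mean transition time is asymptotic to \<open>F r\<^sup>p\<close> for the same constant \<open>F\<close>.
\<close>
lemma subcritical_limit:
  assumes "\<beta> * (real n - 1) < 1"
  shows "((\<lambda>r. M r / r powr p) \<longlongrightarrow> F) at_top"
proof -
  have p: "p = \<beta> * (real n - 1)" using assms by simp
  have F: "F = G powr (real n - 1) * \<gamma>U powr (\<beta> * (real n - 1)) / real n"
  proof -
    have "\<beta> < 1 / (real n - 1)" using assms card_U by (simp add: pos_less_divide_eq)
    then show ?thesis by (simp add: critical_const_def G_powr_minus del: minus_diff_eq)
  qed
  have F_pos: "0 < F" unfolding F using growth params card_U by simp
  have lim: "((\<lambda>r. crossing r (\<kappa> * r powr p) / r powr p) \<longlongrightarrow> F) at_top" if "0 < \<kappa>" for \<kappa>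
    unfolding p F
  proof (rule crossing_asymptotics)
    define e where "e = \<beta> * (real n - 1)"
    have "((\<lambda>r::real. r powr (e - 1)) \<longlongrightarrow> 0) at_top"
      using assms by (intro tendsto_neg_powr filterlim_ident) (simp add: e_def)
    then have "((\<lambda>r. \<gamma>U - (c - \<rho>U) * \<kappa> * r powr (e - 1)) \<longlongrightarrow> \<gamma>U - (c - \<rho>U) * \<kappa> * 0) at_top"
      by (intro tendsto_intros)
    moreover have "eventually (\<lambda>r. \<gamma>U - (c - \<rho>U) * \<kappa> * r powr (e - 1)
        = (\<gamma>U * r - (c - \<rho>U) * (\<kappa> * r powr e)) / r) at_top"
      using eventually_gt_at_top[of 0]
      by eventually_elim (simp add: powr_diff field_simps)
    ultimately have "((\<lambda>r. (\<gamma>U * r - (c - \<rho>U) * (\<kappa> * r powr e)) / r) \<longlongrightarrow> \<gamma>U) at_top"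
      by (simp add: tendsto_cong)
    then show "((\<lambda>r. (\<gamma>U * r - (c - \<rho>U) * (\<kappa> * r powr (\<beta> * (real n - 1)))) / r) \<longlongrightarrow> \<gamma>U) at_top"
      unfolding e_def .
  qed (use that params in auto)
  show ?thesis
    by (rule critical_time_limit[where K = "F + 1"])
       (use F_pos in \<open>auto intro!: eventually_scaled[OF lim]\<close>)
qed

text \<open>
  On the linear scale \<open>s = \<kappa> r\<close> the mean transition time is asymptotic to
  \<open>A (\<gamma>U - (c - \<rho>U) \<kappa>) r\<close> with \<open>A = G powr (n - 1) / n\<close>, and \<open>F\<close> is the fixed point of \<open>\<kappa> \<mapsto> A (\<gamma>U - (c - \<rho>U) \<kappa>)\<close>.
\<close>
lemma critical_limit:
  assumes crit: "\<beta> * (real n - 1) = 1"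
  shows "((\<lambda>r. M r / r powr p) \<longlongrightarrow> F) at_top"
proof -
  have p: "p = 1" using crit by simp
  define A where "A = G powr (real n - 1) / real n"
  have A: "0 < A" using growth card_U by (simp add: A_def)
  have F: "F = \<gamma>U / (1 / A + (c - \<rho>U))"
  proof -
    have "\<beta> = 1 / (real n - 1)" using crit card_U by (simp add: eq_divide_eq)
    then show ?thesis by (simp add: critical_const_def G_powr_minus A_def del: minus_diff_eq)
  qed
  have pos: "0 < 1 / A + (c - \<rho>U)" using A params by (simp add: add_pos_pos)
  have F_pos: "0 < F" unfolding F using pos params by simp
  have F_lt: "F < \<gamma>U / (c - \<rho>U)" unfolding F using pos params A by (intro divide_strict_left_mono) auto
  have fix_point: "\<kappa> < A * (\<gamma>U - (c - \<rho>U) * \<kappa>) \<longleftrightarrow> \<kappa> < F" "A * (\<gamma>U - (c - \<rho>U) * \<kappa>) < \<kappa> \<longleftrightarrow> F < \<kappa>" for \<kappa>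
  proof -
    have "\<kappa> < A * (\<gamma>U - (c - \<rho>U) * \<kappa>) \<longleftrightarrow> \<kappa> / A < \<gamma>U - (c - \<rho>U) * \<kappa>"
      using A by (simp add: pos_divide_less_eq mult.commute)
    also have "\<dots> \<longleftrightarrow> \<kappa> * (1 / A + (c - \<rho>U)) < \<gamma>U" by (simp add: algebra_simps)
    finally show "\<kappa> < A * (\<gamma>U - (c - \<rho>U) * \<kappa>) \<longleftrightarrow> \<kappa> < F" unfolding F using pos by (simp add: pos_less_divide_eq)
    have "A * (\<gamma>U - (c - \<rho>U) * \<kappa>) < \<kappa> \<longleftrightarrow> \<gamma>U - (c - \<rho>U) * \<kappa> < \<kappa> / A"
      using A by (simp add: pos_less_divide_eq mult.commute)
    also have "\<dots> \<longleftrightarrow> \<gamma>U < \<kappa> * (1 / A + (c - \<rho>U))" by (simp add: algebra_simps)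
    finally show "A * (\<gamma>U - (c - \<rho>U) * \<kappa>) < \<kappa> \<longleftrightarrow> F < \<kappa>" unfolding F using pos by (simp add: pos_divide_less_eq)
  qed
  have lim: "((\<lambda>r. crossing r (\<kappa> * r powr p) / r powr p) \<longlongrightarrow> A * (\<gamma>U - (c - \<rho>U) * \<kappa>)) at_top"
    if "0 < \<kappa>" "\<kappa> < \<gamma>U / (c - \<rho>U)" for \<kappa>
  proof -
    have th: "0 < \<gamma>U - (c - \<rho>U) * \<kappa>" using that params by (simp add: field_simps)
    have "((\<lambda>r. crossing r (\<kappa> * r powr p) / r powr (\<beta> * (real n - 1)))
       \<longlongrightarrow> G powr (real n - 1) * (\<gamma>U - (c - \<rho>U) * \<kappa>) powr (\<beta> * (real n - 1)) / real n) at_top"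
      using that by (intro crossing_asymptotics th linear_scale_slope[OF p]) auto
    then show ?thesis using th by (simp only: crit p A_def) simp
  qed
  show ?thesis
  proof (rule critical_time_limit[OF _ _ F_pos F_lt])
    fix \<kappa> assume "0 < \<kappa>" "\<kappa> < F"
    then show "eventually (\<lambda>r. \<kappa> * r powr p \<le> crossing r (\<kappa> * r powr p)) at_top"
      using F_lt by (intro eventually_scaled(1)[OF lim]) (auto simp: fix_point)
  next
    fix \<kappa> assume "F < \<kappa>" "\<kappa> < \<gamma>U / (c - \<rho>U)"
    then show "eventually (\<lambda>r. crossing r (\<kappa> * r powr p) \<le> \<kappa> * r powr p) at_top"
      using F_pos by (intro eventually_scaled(2)[OF lim]) (auto simp: fix_point)
  qed
qed

text \<open>
  As long as the argument of \<open>gU\<close> is a positive multiple of \<open>r\<close>, the mean transition time is of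
  larger order than \<open>r\<close>. Once the argument is negative, the nodes of \<open>U\<close> no longer activate and the
  mean transition time stays bounded. The switch occurs at \<open>\<kappa> = \<gamma>U / (c - \<rho>U)\<close>.
\<close>
lemma supercritical_limit:
  assumes super: "1 < \<beta> * (real n - 1)"
  shows "((\<lambda>r. M r / r powr p) \<longlongrightarrow> F) at_top"
proof -
  have p: "p = 1" using super by simp
  have F: "F = \<gamma>U / (c - \<rho>U)"
  proof -
    have "\<not> \<beta> < 1 / (real n - 1)" "\<beta> \<noteq> 1 / (real n - 1)" using super card_U by (auto simp: field_simps)
    then show ?thesis by (simp add: critical_const_def)
  qed
  have F_pos: "0 < F" unfolding F using params by simp
  show ?thesis
  proof (rule critical_time_limit[OF _ _ F_pos, of "F + 1"])
    fix \<kappa> assume k: "0 < \<kappa>" "\<kappa> < F"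
    then have th: "0 < \<gamma>U - (c - \<rho>U) * \<kappa>" using params by (simp add: F field_simps)
    have lim: "((\<lambda>r. crossing r (\<kappa> * r powr p) / r powr (\<beta> * (real n - 1)))
       \<longlongrightarrow> G powr (real n - 1) * (\<gamma>U - (c - \<rho>U) * \<kappa>) powr (\<beta> * (real n - 1)) / real n) at_top"
      using k by (intro crossing_asymptotics th linear_scale_slope[OF p]) auto
    have "filterlim (\<lambda>r::real. r powr (\<beta> * (real n - 1) - 1)) at_top at_top"
      using super by (intro filterlim_powr_at_top) simp
    then have "filterlim (\<lambda>r. crossing r (\<kappa> * r powr p) / r powr (\<beta> * (real n - 1)) * r powr (\<beta> * (real n - 1) - 1)) at_top at_top"
      by (rule filterlim_tendsto_pos_mult_at_top[OF lim, rotated]) (use th growth card_U in simp)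
    then have "eventually (\<lambda>r. \<kappa> < crossing r (\<kappa> * r powr p) / r powr (\<beta> * (real n - 1)) * r powr (\<beta> * (real n - 1) - 1)) at_top"
      by (simp only: filterlim_at_top_dense)
    then show "eventually (\<lambda>r. \<kappa> * r powr p \<le> crossing r (\<kappa> * r powr p)) at_top"
      using eventually_gt_at_top[of 0]
    proof eventually_elim
      case (elim r)
      then have "\<kappa> < crossing r (\<kappa> * r powr p) / r" by (simp add: powr_diff)
      then show ?case using elim by (simp add: p pos_less_divide_eq)
    qed
  next
    fix \<kappa> assume k: "F < \<kappa>"
    then have k0: "0 < \<kappa>" using F_pos by simp
    have "filterlim (\<lambda>r. rate_V r (\<kappa> * r powr p)) at_top at_top"
      using k0 by (intro rate_V_at_top) auto
    then have "eventually (\<lambda>r. 1 \<le> rate_V r (\<kappa> * r powr p)) at_top"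
      by (simp add: filterlim_at_top)
    then show "eventually (\<lambda>r. crossing r (\<kappa> * r powr p) \<le> \<kappa> * r powr p) at_top"
      using eventually_gt_at_top[of 0] eventually_ge_at_top[of "crossing_time n m 0 1 / \<kappa>"]
    proof eventually_elim
      case (elim r)
      have "\<gamma>U * r - (c - \<rho>U) * (\<kappa> * r powr p) = (\<gamma>U - (c - \<rho>U) * \<kappa>) * r"
        using elim unfolding p by (simp add: algebra_simps)
      also have "\<dots> \<le> 0"
      proof (rule mult_nonpos_nonneg)
        show "\<gamma>U - (c - \<rho>U) * \<kappa> \<le> 0" using k params by (simp add: F field_simps)
      qed (use elim in simp)
      finally have "rate_U r (\<kappa> * r powr p) = 0"
        unfolding external_rate_U_def by (rule class_GD(4)[OF gU])
      then have "crossing r (\<kappa> * r powr p) \<le> crossing_time n m 0 1"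
        unfolding crossing_def using elim by (intro crossing_time_mono) auto
      also have "\<dots> \<le> \<kappa> * r powr p" using elim k0 by (simp add: p pos_divide_le_eq mult.commute)
      finally show ?case .
    qed
  qed simp
qed

lemma critical_time_asymptotics: "M \<sim>[at_top] (\<lambda>r. F * r powr p)"
proof (rule asymp_equivI'_const)
  show "((\<lambda>r. M r / r powr p) \<longlongrightarrow> F) at_top"
    using subcritical_limit critical_limit supercritical_limit
    by (cases "\<beta> * (real n - 1)" "1 :: real" rule: linorder_cases)
  have "0 < real n * G powr - (real n - 1) + (c - \<rho>U)"
    using growth card_U params by (intro add_pos_pos) simp_all
  then show "F \<noteq> 0"
    using params growth card_U by (auto simp: critical_const_def simp del: minus_diff_eq)
qed

end

theorem theorem1p6:
  fixes U V :: "'a set" and gU gV :: "real \<Rightarrow> real"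
    and c \<rho>U \<rho>V \<gamma>U \<gamma>V \<beta> G :: real
  assumes "finite U" "finite V" "U \<noteq> {}" "V \<noteq> {}" "U \<inter> V = {}"
    and "c > \<rho>U" "\<rho>U > 0" "c > \<rho>V" "\<rho>V > 0"
    and "\<gamma>U \<ge> \<gamma>V" "\<gamma>V > 0"
    and "gU \<in> class_G" "gV \<in> class_G"
    and "filterlim (\<lambda>x. gV x / gU x) at_top at_top"
    and "card U \<ge> 2"
    and "\<beta> > 0" "G > 0"
    and "gU \<sim>[at_top] (\<lambda>x. G * x powr \<beta>)"
  shows "(\<forall>r>0. \<exists>!M. is_critical_time U V (external_rate_U gU \<gamma>U c \<rho>U r) (external_rate_V gV \<gamma>V \<rho>V r) M) \<and>
    (\<lambda>r. critical_time U V (external_rate_U gU \<gamma>U c \<rho>U r) (external_rate_V gV \<gamma>V \<rho>V r))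
      \<sim>[at_top] (\<lambda>r. critical_const (card U) \<beta> G \<gamma>U c \<rho>U * r powr min 1 (\<beta> * (real (card U) - 1)))"
proof -
  interpret external_model U V gU gV c \<rho>U \<rho>V \<gamma>U \<gamma>V \<beta> G
    by unfold_locales (use assms in auto)
  show ?thesis
    using frozen_rates.ex1_critical_time[OF frozen] critical_time_asymptotics by blast
qed

end
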